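(* Let $H_1,H_2$ be real Hilbert spaces (possibly infinite dimensional), let $g:H_1\to\mathbb{R}\cup\{\infty\}$ and $f:H_2\to\mathbb{R}\cup\{\infty\}$ be proper, convex and lower semicontinuous, let $L:H_1\to H_2$ be a bounded linear operator, and let $\lambda>0$. Assume that both the primal problem $(P)$ and the dual problem $(D)$ have optimal solutions, that at least one of the regularity conditions (R1), (R2) of the context holds, and that $L^*L:H_1\to H_1$ is surjective. Then, for any initial elements $b^0,d^0\in H_2$, the alternating split Bregman algorithm is well defined, and the sequences $\{b^k\}$ and $\{d^k\}$ it generates converge weakly in $H_2$ to some $\hat b$ and $\hat d$, respectively. Moreover, $\lambda\hat b$ is a solution of the dual problem $(D)$, the sequence $\{d^k-Lu^{k+1}\}$ converges strongly to zero, and $$\sum_{k=0}^{\infty}\|d^k-Lu^{k+1}\|^2<\infty .$$ Furthermore, there exists a unique $\hat u\in H_1$ such that $L\hat u=\hat d$, and this $\hat u$ is a solution of the primal problem $(P)$. In particular, $\{u^k\}$ has at most one weak cluster point, and any such weak cluster point $\bar u$ satisfies $\bar u=\hat u$.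
   Context: Hilbert spaces are identified with their duals; $L^*:H_2\to H_1$ is the adjoint of $L$; $f^*,g^*$ denote the convex (Fenchel) conjugates; $\mathrm{dom}$ denotes the effective domain. Primal problem $(P)$: $\min_{u\in H_1}\{g(u)+f(Lu)\}$. Dual problem $(D)$: $-\min_{b\in H_2}\{g^*(-L^*b)+f^*(b)\}$; a solution of $(D)$ is a minimizer over $b\in H_2$ of $g^*(-L^*b)+f^*(b)$. Regularity conditions: (R1) there exists $x\in\mathrm{dom}(g)\cap\mathrm{dom}(f\circ L)$ such that $f$ is continuous at $Lx$; (R2) $0\in\mathrm{int}\,(L\,\mathrm{dom}(g)-\mathrm{dom}(f))$. Alternating split Bregman algorithm: given $b^0,d^0\in H_2$, for $k\ge1$: (1) let $u^k$ be a minimizer over $H_1$ of $I_1^k(u)=g(u)+\frac{\lambda}{2}\|b^{k-1}+Lu-d^{k-1}\|^2$; (2) let $d^k$ be the minimizer over $H_2$ of $I_2^k(d)=f(d)+\frac{\lambda}{2}\|b^{k-1}+Lu^k-d\|^2$; (3) set $b^k=b^{k-1}+Lu^k-d^k$. The algorithm is said to be well defined if for all $k\ge1$ the functionals $I_1^k$ and $I_2^k$ have minimizers in $H_1$ and $H_2$, respectively. *)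

theory Defs
  imports "HOL-Analysis.Analysis"
begin

section \<open>Extended-real-valued convex functions\<close>

text \<open>Functions into the reals extended by plus infinity are rendered as \<^typ>\<open>ereal\<close>-valued
  functions; properness excludes the value minus infinity.\<close>

definition proper_fun :: "('a \<Rightarrow> ereal) \<Rightarrow> bool" where
  "proper_fun f \<longleftrightarrow> (\<forall>x. f x \<noteq> -\<infinity>) \<and> (\<exists>x. f x \<noteq> \<infinity>)"

definition eff_dom :: "('a \<Rightarrow> ereal) \<Rightarrow> 'a set" where
  "eff_dom f = {x. f x < \<infinity>}"

definition convex_fun :: "('a::real_vector \<Rightarrow> ereal) \<Rightarrow> bool" where
  "convex_fun f \<longleftrightarrow> (\<forall>x y t. 0 < t \<and> t < 1 \<longrightarrow>
     f ((1 - t) *\<^sub>R x + t *\<^sub>R y) \<le> ereal (1 - t) * f x + ereal t * f y)"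

definition lsc_fun :: "('a::topological_space \<Rightarrow> ereal) \<Rightarrow> bool" where
  "lsc_fun f \<longleftrightarrow> (\<forall>x. f x \<le> Liminf (at x) f)"

definition fenchel_conj :: "('a::real_inner \<Rightarrow> ereal) \<Rightarrow> 'a \<Rightarrow> ereal" where
  "fenchel_conj f y = (SUP x. ereal (x \<bullet> y) - f x)"

definition is_minimizer :: "('a \<Rightarrow> ereal) \<Rightarrow> 'a \<Rightarrow> bool" where
  "is_minimizer \<phi> x \<longleftrightarrow> is_arg_min \<phi> (\<lambda>_. True) x"

lemma is_minimizer_iff: "is_minimizer \<phi> x \<longleftrightarrow> (\<forall>y. \<phi> x \<le> \<phi> y)"
  by (simp add: is_minimizer_def is_arg_min_linorder)

section \<open>Primal and dual problem\<close>

definition primal_obj ::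
  "('a \<Rightarrow> ereal) \<Rightarrow> ('b \<Rightarrow> ereal) \<Rightarrow> ('a \<Rightarrow> 'b) \<Rightarrow> 'a \<Rightarrow> ereal" where
  "primal_obj g f L u = g u + f (L u)"

definition dual_obj ::
  "('a::real_inner \<Rightarrow> ereal) \<Rightarrow> ('b::real_inner \<Rightarrow> ereal) \<Rightarrow> ('a \<Rightarrow> 'b) \<Rightarrow> 'b \<Rightarrow> ereal" where
  "dual_obj g f L b = fenchel_conj g (- adjoint L b) + fenchel_conj f b"

definition primal_solution ::
  "('a \<Rightarrow> ereal) \<Rightarrow> ('b \<Rightarrow> ereal) \<Rightarrow> ('a \<Rightarrow> 'b) \<Rightarrow> 'a \<Rightarrow> bool" where
  "primal_solution g f L u \<longleftrightarrow> is_minimizer (primal_obj g f L) u"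

definition dual_solution ::
  "('a::real_inner \<Rightarrow> ereal) \<Rightarrow> ('b::real_inner \<Rightarrow> ereal) \<Rightarrow> ('a \<Rightarrow> 'b) \<Rightarrow> 'b \<Rightarrow> bool" where
  "dual_solution g f L b \<longleftrightarrow> is_minimizer (dual_obj g f L) b"

definition regularity_R1 ::
  "('a \<Rightarrow> ereal) \<Rightarrow> ('b::t2_space \<Rightarrow> ereal) \<Rightarrow> ('a \<Rightarrow> 'b) \<Rightarrow> bool" where
  "regularity_R1 g f L \<longleftrightarrow> (\<exists>x \<in> eff_dom g \<inter> eff_dom (f \<circ> L). isCont f (L x))"

definition regularity_R2 ::
  "('a \<Rightarrow> ereal) \<Rightarrow> ('b::real_normed_vector \<Rightarrow> ereal) \<Rightarrow> ('a \<Rightarrow> 'b) \<Rightarrow> bool" where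
  "regularity_R2 g f L \<longleftrightarrow> 0 \<in> interior {L x - y | x y. x \<in> eff_dom g \<and> y \<in> eff_dom f}"

section \<open>Alternating split Bregman algorithm\<close>

text \<open>In the definitions below \<open>b'\<close> and \<open>d'\<close> are the previous iterates.\<close>

definition asb_I1 ::
  "('a \<Rightarrow> ereal) \<Rightarrow> ('a \<Rightarrow> 'b::real_normed_vector) \<Rightarrow> real \<Rightarrow> 'b \<Rightarrow> 'b \<Rightarrow> 'a \<Rightarrow> ereal" where
  "asb_I1 g L lam b' d' u = g u + ereal (lam / 2 * (norm (b' + L u - d'))\<^sup>2)"

definition asb_I2 ::
  "('b \<Rightarrow> ereal) \<Rightarrow> ('a \<Rightarrow> 'b::real_normed_vector) \<Rightarrow> real \<Rightarrow> 'b \<Rightarrow> 'a \<Rightarrow> 'b \<Rightarrow> ereal" where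
  "asb_I2 f L lam b' u d = f d + ereal (lam / 2 * (norm (b' + L u - d))\<^sup>2)"

definition asb_step ::
  "('a \<Rightarrow> ereal) \<Rightarrow> ('b \<Rightarrow> ereal) \<Rightarrow> ('a \<Rightarrow> 'b::real_normed_vector) \<Rightarrow> real
    \<Rightarrow> 'b \<Rightarrow> 'b \<Rightarrow> 'a \<Rightarrow> 'b \<Rightarrow> 'b \<Rightarrow> bool" where
  "asb_step g f L lam b' d' u d b \<longleftrightarrow>
     is_minimizer (asb_I1 g L lam b' d') u \<and>
     is_minimizer (asb_I2 f L lam b' u) d \<and>
     b = b' + L u - d"

text \<open>The iterate \<open>u 0\<close> is not used by the algorithm and is left unconstrained.\<close>

definition asb_sequence ::
  "('a \<Rightarrow> ereal) \<Rightarrow> ('b \<Rightarrow> ereal) \<Rightarrow> ('a \<Rightarrow> 'b::real_normed_vector) \<Rightarrow> real \<Rightarrow> 'b \<Rightarrow> 'b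
    \<Rightarrow> (nat \<Rightarrow> 'a) \<Rightarrow> (nat \<Rightarrow> 'b) \<Rightarrow> (nat \<Rightarrow> 'b) \<Rightarrow> bool" where
  "asb_sequence g f L lam b0 d0 u d b \<longleftrightarrow>
     b 0 = b0 \<and> d 0 = d0 \<and>
     (\<forall>k. asb_step g f L lam (b k) (d k) (u (Suc k)) (d (Suc k)) (b (Suc k)))"

text \<open>The functionals depend on the previously computed iterates. Hence well-definedness says that
  the algorithm never gets stuck: however its first \<open>n\<close> steps were carried out, the functionals of
  step \<open>n + 1\<close> have minimizers.\<close>

definition asb_well_defined ::
  "('a \<Rightarrow> ereal) \<Rightarrow> ('b \<Rightarrow> ereal) \<Rightarrow> ('a \<Rightarrow> 'b::real_normed_vector) \<Rightarrow> real \<Rightarrow> 'b \<Rightarrow> 'b \<Rightarrow> bool" where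
  "asb_well_defined g f L lam b0 d0 \<longleftrightarrow>
     (\<forall>n u d b. b 0 = b0 \<and> d 0 = d0 \<and>
        (\<forall>k<n. asb_step g f L lam (b k) (d k) (u (Suc k)) (d (Suc k)) (b (Suc k))) \<longrightarrow>
        (\<exists>u'. is_minimizer (asb_I1 g L lam (b n) (d n)) u') \<and>
        (\<forall>u'. is_minimizer (asb_I1 g L lam (b n) (d n)) u' \<longrightarrow>
           (\<exists>d'. is_minimizer (asb_I2 f L lam (b n) u') d')))"

section \<open>Weak topology\<close>

text \<open>The coarsest topology making all functionals given by an inner product with a fixed vector
  continuous; by the Riesz representation theorem these are all continuous linear functionals on a
  Hilbert space.\<close>

definition weak_topology :: "'a::real_inner topology" where
  "weak_topology = topology_generated_by {{x. x \<bullet> y \<in> U} | y U. open (U :: real set)}"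

definition weakly_converges :: "(nat \<Rightarrow> 'a::real_inner) \<Rightarrow> 'a \<Rightarrow> bool" where
  "weakly_converges X l \<longleftrightarrow> limitin weak_topology X l sequentially"

text \<open>Cluster points are meant in the topological sense; they include all limits of weakly
  convergent subsequences.\<close>

definition weak_cluster_point :: "(nat \<Rightarrow> 'a::real_inner) \<Rightarrow> 'a \<Rightarrow> bool" where
  "weak_cluster_point X l \<longleftrightarrow>
     (\<forall>U. openin weak_topology U \<and> l \<in> U \<longrightarrow> (\<exists>\<^sub>F n in sequentially. X n \<in> U))"

lemma openin_weak_topology_subbasis:
  "open U \<Longrightarrow> openin weak_topology {x. x \<bullet> y \<in> U}" for U :: "real set"
  unfolding weak_topology_def by (intro topology_generated_by_Basis) blast

lemma topspace_weak_topology [simp]: "topspace weak_topology = UNIV"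
  using openin_subset[OF openin_weak_topology_subbasis[OF open_UNIV]] by auto

lemma eventually_weak_topology:
  assumes lim: "\<And>y. ((\<lambda>n. X n \<bullet> y) \<longlongrightarrow> l \<bullet> y) F"
    and "openin weak_topology V" "l \<in> V"
  shows "eventually (\<lambda>n. X n \<in> V) F"
proof -
  have "generate_topology_on {{x. x \<bullet> y \<in> U} | y U. open (U :: real set)} V"
    using assms(2) by (simp add: weak_topology_def openin_topology_generated_by_iff)
  then have "l \<in> V \<longrightarrow> eventually (\<lambda>n. X n \<in> V) F"
  proof (induction rule: generate_topology_on.induct)
    case (Int a b)
    then show ?case by (auto intro: eventually_conj)
  next
    case (UN K)
    show ?case
    proof
      assume "l \<in> \<Union>K"
      then obtain k where "k \<in> K" "l \<in> k" by blast
      with UN.IH show "eventually (\<lambda>n. X n \<in> \<Union>K) F"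
        by (blast intro: eventually_mono)
    qed
  next
    case (Basis s)
    then obtain y U where s: "s = {x. x \<bullet> y \<in> U}" "open U" by blast
    then show ?case using topological_tendstoD[OF lim[of y], of U] by simp
  qed auto
  with assms(3) show ?thesis by blast
qed

lemma weakly_converges_iff: "weakly_converges X l \<longleftrightarrow> (\<forall>y. (\<lambda>n. X n \<bullet> y) \<longlonglongrightarrow> l \<bullet> y)"
proof
  assume L: "weakly_converges X l"
  show "\<forall>y. (\<lambda>n. X n \<bullet> y) \<longlonglongrightarrow> l \<bullet> y"
  proof (intro allI topological_tendstoI)
    fix y and U :: "real set"
    assume "open U" "l \<bullet> y \<in> U"
    then show "eventually (\<lambda>n. X n \<bullet> y \<in> U) sequentially"
      using L openin_weak_topology_subbasis[of U y]
      by (auto simp: weakly_converges_def limitin_def)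
  qed
next
  assume "\<forall>y. (\<lambda>n. X n \<bullet> y) \<longlonglongrightarrow> l \<bullet> y"
  then show "weakly_converges X l"
    by (auto simp: weakly_converges_def limitin_def intro: eventually_weak_topology)
qed

end

theory Submission
  imports Defs
begin

text \<open>
  Put \<open>w = L u\<close> and let \<open>h w\<close> be \<open>g u\<close> if \<open>w = L u\<close> and \<open>\<infinity>\<close> if \<open>w\<close> is not in the range of \<open>L\<close>.  Since
  \<open>L\<^sup>* L\<close> is onto and symmetric, \<open>L\<close> is injective and \<open>h\<close> is well defined, convex, and again lower
  semicontinuous.  The last point is the main use of surjectivity: if \<open>L (u n)\<close> converges, then
  \<open>u n \<bullet> L\<^sup>* (L y) = L (u n) \<bullet> L y\<close> converges for every \<open>y\<close>, so \<open>u n\<close> converges weakly, and \<open>g\<close> is weakly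
  lower semicontinuous.  In this way the problem moves entirely to \<open>H\<^sub>2\<close>: minimize \<open>h + f\<close>, with dual
  objective \<open>h\<^sup>*(-p) + f\<^sup>*(p)\<close>, and the algorithm alternates proximal points of \<open>h\<close> and of \<open>f\<close>.

  To keep all arithmetic in the real numbers, functions are represented by their epigraphs, which are
  closed convex subsets of \<open>H\<^sub>2 \<times> \<real>\<close>; \<open>subgrad E p x a\<close> says that the affine function of slope \<open>p\<close> through the point
  \<open>(x, a)\<close> of \<open>E\<close> lies below \<open>E\<close>.  The Hilbert space tools (projections, Riesz representation, adjoints)
  all come from one existence result, \<open>proximal_point_exists\<close>.  Weak compactness is used
  along filters rather than subsequences, \<open>bounded_imp_weak_cluster\<close>, so that it follows directly
  from Tychonoff's theorem.

  The proof has two parts.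

  \<^item> No duality gap.  Under either regularity condition the perturbation function
    \<open>y \<mapsto> inf {h x + f (x + y) | x}\<close> is bounded above near \<open>0\<close>.  If \<open>f\<close> is continuous at a
    feasible point, this is immediate; under the interior condition it is a Baire category argument
    (\<open>interior_imp_perturbation_bounded\<close>).  A separation argument then yields \<open>e\<close>-optimal dual points for every
    \<open>e > 0\<close> (\<open>approximate_dual_exists\<close>), so the optimal values of the two problems are opposite, and the given
    solutions form a saddle point, that is, they satisfy \<open>-p \<in> \<partial>h x\<close> and \<open>p \<in> \<partial>f x\<close>.

  \<^item> Convergence.  The optimality conditions of the two steps say that \<open>z k = b k + d k\<close> follows the
    Douglas--Rachford iteration for the dual problem.  Monotonicity of subgradients gives
    \<open>\<parallel>z (k+1) - z'\<parallel>\<^sup>2 + \<parallel>d k - L (u (k+1))\<parallel>\<^sup>2 \<le> \<parallel>z k - z'\<parallel>\<^sup>2\<close> for \<open>k \<ge> 1\<close> and each \<open>z'\<close>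
    that is the sum of the two parts of a saddle point (\<open>fejer_inequality\<close>), hence boundedness and
    summability of the residuals. Every weak cluster point of the pairs \<open>(b k, d k)\<close> is a saddle
    point (\<open>weak_cluster_saddle\<close>), and by Opial's argument there is only one
    (\<open>weak_cluster_unique\<close>). So \<open>b k\<close> and \<open>d k\<close> converge weakly and their
    limits solve the dual and the primal problem.
\<close>

section \<open>Subgradients of epigraphs and proximal points\<close>

text \<open>If \<open>E\<close> is the epigraph of a convex function \<open>f\<close>, the second conjunct forces \<open>a = f x\<close>, so the
  predicate expresses \<open>p \<in> \<partial>f x\<close> together with the value of \<open>f\<close> at \<open>x\<close>.\<close>

definition subgrad :: "('a::real_inner \<times> real) set \<Rightarrow> 'a \<Rightarrow> 'a \<Rightarrow> real \<Rightarrow> bool" where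
  "subgrad E p x a \<longleftrightarrow> (x, a) \<in> E \<and> (\<forall>y t. (y, t) \<in> E \<longrightarrow> a + p \<bullet> (y - x) \<le> t)"

lemma subgradI:
  "(x, a) \<in> E \<Longrightarrow> (\<And>y t. (y, t) \<in> E \<Longrightarrow> a + p \<bullet> (y - x) \<le> t) \<Longrightarrow> subgrad E p x a"
  by (simp add: subgrad_def)

lemma subgrad_in: "subgrad E p x a \<Longrightarrow> (x, a) \<in> E"
  by (simp add: subgrad_def)

lemma subgrad_le: "subgrad E p x a \<Longrightarrow> (y, t) \<in> E \<Longrightarrow> a + p \<bullet> (y - x) \<le> t"
  by (simp add: subgrad_def)

lemma subgrad_monotone:
  assumes "subgrad E p x a" "subgrad E q y b"
  shows "(p - q) \<bullet> (x - y) \<ge> 0"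
  using subgrad_le[OF assms(1) subgrad_in[OF assms(2)]] subgrad_le[OF assms(2) subgrad_in[OF assms(1)]]
  by (simp add: algebra_simps)

lemma norm_diff_square_expand:
  fixes x y c :: "'a::real_inner"
  shows "(norm (y - c))\<^sup>2 = (norm (x - c))\<^sup>2 - 2 * ((c - x) \<bullet> (y - x)) + (norm (y - x))\<^sup>2"
  by (simp add: power2_norm_eq_inner algebra_simps inner_commute)

lemma subgrad_imp_minimal:
  assumes "subgrad E (l *\<^sub>R (c - x)) x a" "(y, t) \<in> E" "0 \<le> l"
  shows "a + l / 2 * (norm (x - c))\<^sup>2 \<le> t + l / 2 * (norm (y - c))\<^sup>2"
proof -
  have "a + l * ((c - x) \<bullet> (y - x)) \<le> t"
    using subgrad_le[OF assms(1,2)] by simp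
  moreover have "0 \<le> l / 2 * (norm (y - x))\<^sup>2"
    using assms(3) by simp
  ultimately show ?thesis
    unfolding norm_diff_square_expand[of y c x] by (simp add: algebra_simps)
qed

text \<open>Moving from the minimizer by a fraction \<open>s\<close> of the way to another
  point changes the quadratic term to first order in \<open>s\<close> and the rest is of order \<open>s\<^sup>2\<close>; dividing by
  \<open>s\<close> and letting \<open>s\<close> tend to zero leaves the subgradient inequality.\<close>

lemma minimal_imp_subgrad:
  assumes cvx: "convex E" and E: "(x, a) \<in> E"
    and min: "\<And>y t. (y, t) \<in> E \<Longrightarrow> a + l / 2 * (norm (x - c))\<^sup>2 \<le> t + l / 2 * (norm (y - c))\<^sup>2"
  shows "subgrad E (l *\<^sub>R (c - x)) x a"
proof (rule subgradI[OF E])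
  fix y t assume yt: "(y, t) \<in> E"
  define q where "q = l / 2 * (norm (y - x))\<^sup>2"
  define P where "P = (c - x) \<bullet> (y - x)"
  define r where "r = a + l * P - t"
  have le: "r \<le> s * q" if s: "0 < s" "s < 1" for s
  proof -
    have "(1 - s) *\<^sub>R (x, a) + s *\<^sub>R (y, t) \<in> E"
      using convexD[OF cvx E yt, of "1 - s" s] s by simp
    then have "(x + s *\<^sub>R (y - x), a + s * (t - a)) \<in> E"
      by (simp add: algebra_simps)
    note min[OF this]
    also have "(norm (x + s *\<^sub>R (y - x) - c))\<^sup>2
        = (norm (x - c))\<^sup>2 - 2 * s * P + s\<^sup>2 * (norm (y - x))\<^sup>2"
      using norm_diff_square_expand[of "x + s *\<^sub>R (y - x)" c x]
      by (simp add: power_mult_distrib P_def)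
    finally have "0 \<le> s * (s * q - r)"
      by (simp add: q_def r_def algebra_simps power2_eq_square)
    with s show ?thesis by (simp add: zero_le_mult_iff)
  qed
  have "((\<lambda>s. s * q) \<longlongrightarrow> 0 * q) (at_right 0)"
    by (intro tendsto_intros)
  moreover have "eventually (\<lambda>s. r \<le> s * q) (at_right 0)"
    using eventually_at_right_less[of "0::real"] le
    by (auto simp: eventually_at_right[of 0 1] intro!: exI[of _ 1])
  ultimately have "r \<le> 0 * q"
    by (rule tendsto_lowerbound) simp
  then show "a + (l *\<^sub>R (c - x)) \<bullet> (y - x) \<le> t"
    by (simp add: r_def P_def)
qed

text \<open>The objective \<open>a + l/2 \<parallel>x - c\<parallel>\<^sup>2\<close> is strongly convex: at the midpoint of two points it drops
  below the mean value by \<open>l/8\<close> times the squared distance.  Hence minimizing sequences are Cauchy.\<close>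

lemma proximal_point_exists:
  fixes E :: "('a::{real_inner, complete_space} \<times> real) set"
  assumes cl: "closed E" and cvx: "convex E" and ne: "E \<noteq> {}" and l: "0 < l"
    and bd: "\<And>x a. (x, a) \<in> E \<Longrightarrow> m \<le> a + l / 2 * (norm (x - c))\<^sup>2"
  shows "\<exists>x a. subgrad E (l *\<^sub>R (c - x)) x a"
proof -
  define \<phi> where "\<phi> z = snd z + l / 2 * (norm (fst z - c))\<^sup>2" for z :: "'a \<times> real"
  define I where "I = Inf (\<phi> ` E)"
  have bdd: "bdd_below (\<phi> ` E)"
    by (rule bdd_belowI2[of _ m]) (use bd in \<open>force simp: \<phi>_def\<close>)
  have I_le: "I \<le> \<phi> z" if "z \<in> E" for z
    unfolding I_def using bdd that by (intro cInf_lower) auto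
  have "\<exists>z\<in>E. \<phi> z < I + inverse (real (Suc n))" for n
    using cInf_lessD[of "\<phi> ` E" "I + inverse (real (Suc n))"] ne by (auto simp: I_def)
  then obtain s where sE: "\<And>n. s n \<in> E" and s_less: "\<And>n. \<phi> (s n) < I + inverse (real (Suc n))"
    by metis
  define x where "x n = fst (s n)" for n
  have mid: "l / 4 * (norm (fst z - fst w))\<^sup>2 \<le> \<phi> z + \<phi> w - 2 * I" if "z \<in> E" "w \<in> E" for z w
  proof -
    have "(1/2) *\<^sub>R z + (1/2) *\<^sub>R w \<in> E"
      using convexD[OF cvx that, of "1/2" "1/2"] by simp
    from I_le[OF this] have "2 * I \<le> 2 * \<phi> ((1/2) *\<^sub>R z + (1/2) *\<^sub>R w)"
      by simp
    also have "\<dots> = \<phi> z + \<phi> w - l / 4 * (norm (fst z - fst w))\<^sup>2"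
      by (simp add: \<phi>_def power2_norm_eq_inner algebra_simps inner_commute)
    finally show ?thesis by simp
  qed
  have "Cauchy x"
  proof (rule metric_CauchyI)
    fix e :: real assume e: "0 < e"
    have "0 < l / 8 * e\<^sup>2" using e l by simp
    then obtain N where N: "inverse (real (Suc N)) < l / 8 * e\<^sup>2"
      using reals_Archimedean by blast
    have "dist (x i) (x j) < e" if "N \<le> i" "N \<le> j" for i j
    proof -
      have "\<phi> (s k) < I + l / 8 * e\<^sup>2" if "N \<le> k" for k
      proof -
        have "inverse (real (Suc k)) \<le> inverse (real (Suc N))"
          using that by (simp add: le_imp_inverse_le)
        with s_less[of k] N show ?thesis by linarith
      qed
      from this[of i] this[of j] that mid[OF sE sE, of i j]
      have "l / 4 * (norm (x i - x j))\<^sup>2 < l / 4 * e\<^sup>2"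
        by (simp add: x_def)
      then have "(norm (x i - x j))\<^sup>2 < e\<^sup>2" using l by simp
      then show ?thesis using e by (simp add: dist_norm power2_less_imp_less)
    qed
    then show "\<exists>M. \<forall>m\<ge>M. \<forall>n\<ge>M. dist (x m) (x n) < e" by blast
  qed
  then obtain x0 where x0: "x \<longlonglongrightarrow> x0"
    using Cauchy_convergent convergent_def by blast
  have "(\<lambda>n. \<phi> (s n)) \<longlonglongrightarrow> I"
  proof (rule tendsto_sandwich[OF _ _ tendsto_const])
    show "(\<lambda>n. I + inverse (real (Suc n))) \<longlonglongrightarrow> I"
      using tendsto_add[OF tendsto_const LIMSEQ_inverse_real_of_nat, of I] by simp
    show "\<forall>\<^sub>F n in sequentially. I \<le> \<phi> (s n)"
      using I_le sE by (auto intro: always_eventually)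
    show "\<forall>\<^sub>F n in sequentially. \<phi> (s n) \<le> I + inverse (real (Suc n))"
      using s_less less_imp_le by (blast intro: always_eventually)
  qed
  then have "(\<lambda>n. \<phi> (s n) - l / 2 * (norm (x n - c))\<^sup>2) \<longlonglongrightarrow> I - l / 2 * (norm (x0 - c))\<^sup>2"
    by (intro tendsto_intros x0)
  then have "(\<lambda>n. snd (s n)) \<longlonglongrightarrow> I - l / 2 * (norm (x0 - c))\<^sup>2"
    by (simp add: \<phi>_def x_def)
  with x0 have "(\<lambda>n. (fst (s n), snd (s n))) \<longlonglongrightarrow> (x0, I - l / 2 * (norm (x0 - c))\<^sup>2)"
    unfolding x_def by (rule tendsto_Pair)
  then have in_E: "(x0, I - l / 2 * (norm (x0 - c))\<^sup>2) \<in> E"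
    using closed_sequentially[OF cl, of "\<lambda>n. (fst (s n), snd (s n))"] sE by auto
  have "subgrad E (l *\<^sub>R (c - x0)) x0 (I - l / 2 * (norm (x0 - c))\<^sup>2)"
    using I_le by (intro minimal_imp_subgrad[OF cvx in_E]) (force simp: \<phi>_def)
  then show ?thesis by blast
qed

text \<open>The projection of \<open>c\<close> is the proximal point of the indicator function of \<open>C\<close>, whose graph is
  \<open>C \<times> {0}\<close>; the subgradient inequality of this graph is the variational characterization of the projection.\<close>

lemma convex_projection_exists:
  fixes C :: "'a::{real_inner, complete_space} set"
  assumes "closed C" "convex C" "C \<noteq> {}"
  shows "\<exists>x\<in>C. \<forall>y\<in>C. (c - x) \<bullet> (y - x) \<le> 0"
proof -
  have "\<exists>x a. subgrad (C \<times> {0}) (2 *\<^sub>R (c - x)) x a"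
    using assms by (intro proximal_point_exists[where m = 0] closed_Times convex_Times) auto
  then show ?thesis
    by (fastforce simp: subgrad_def)
qed

text \<open>The representing vector is the proximal point of the graph of \<open>-\<phi>\<close>, that is, the minimizer of
  \<open>\<parallel>x\<parallel>\<^sup>2/2 - \<phi> x\<close>.\<close>

lemma riesz_representation:
  fixes \<phi> :: "'a::{real_inner, complete_space} \<Rightarrow> real"
  assumes "bounded_linear \<phi>"
  shows "\<exists>x. \<forall>y. \<phi> y = x \<bullet> y"
proof -
  interpret bounded_linear \<phi> by fact
  obtain K where K: "\<And>x. norm (\<phi> x) \<le> norm x * K" using bounded by blast
  let ?E = "{(x, a). a = - \<phi> x}"
  have "closed ?E"
  proof -
    have "?E = {z. snd z = - \<phi> (fst z)}" by auto
    also have "closed \<dots>"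
      by (intro closed_Collect_eq continuous_intros continuous_on continuous_on_fst)
    finally show ?thesis .
  qed
  moreover have "convex ?E"
    by (auto simp: convex_def add scaleR algebra_simps)
  moreover have "- K\<^sup>2 / 2 \<le> a + 1 / 2 * (norm (x - 0))\<^sup>2" if "(x, a) \<in> ?E" for x a
  proof -
    have "\<phi> x \<le> norm x * K" using K[of x] by simp
    moreover have "0 \<le> (norm x - K)\<^sup>2" by simp
    ultimately show ?thesis using that by (simp add: power2_diff algebra_simps)
  qed
  ultimately obtain x a where sg: "subgrad ?E (1 *\<^sub>R (0 - x)) x a"
    using proximal_point_exists[of ?E 1 "- K\<^sup>2 / 2" 0] by force
  \<comment> \<open>Along a linear graph the subgradient inequality at \<open>x\<close> is a bound for \<open>\<phi>\<close> that, applied to \<open>y\<close>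
    and \<open>-y\<close>, becomes an equation.\<close>
  have le: "\<phi> z \<le> x \<bullet> z" for z
    using subgrad_le[OF sg, of "x + z" "- \<phi> (x + z)"] subgrad_in[OF sg] by (simp add: add)
  have "\<phi> y = x \<bullet> y" for y
    using le[of y] le[of "- y"] linear_neg[OF linear_axioms, of y] by simp
  then show ?thesis by blast
qed

text \<open>The adjoint is a choice of a map with this property; such a map exists by Riesz
  representation of the functionals \<open>x \<mapsto> L x \<bullet> y\<close>.\<close>

lemma adjoint_inner:
  fixes L :: "'a::{real_inner, complete_space} \<Rightarrow> 'b::real_inner"
  assumes "bounded_linear L"
  shows "L x \<bullet> y = x \<bullet> adjoint L y"
proof -
  have "\<exists>z. \<forall>x. L x \<bullet> y = z \<bullet> x" for y
    using riesz_representation[OF bounded_linear_compose[OF bounded_linear_inner_left assms]] by auto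
  then obtain A where "\<forall>x y. L x \<bullet> y = x \<bullet> A y"
    by (metis inner_commute)
  then show ?thesis using adjoint_unique by metis
qed

section \<open>Weak limits along filters\<close>

definition weak_lim :: "('i \<Rightarrow> 'a::real_inner) \<Rightarrow> 'a \<Rightarrow> 'i filter \<Rightarrow> bool" where
  "weak_lim X l F \<longleftrightarrow> (\<forall>y. ((\<lambda>n. X n \<bullet> y) \<longlongrightarrow> l \<bullet> y) F)"

lemma weak_limD: "weak_lim X l F \<Longrightarrow> ((\<lambda>n. X n \<bullet> y) \<longlongrightarrow> l \<bullet> y) F"
  by (simp add: weak_lim_def)

lemma weak_lim_mono: "weak_lim X l F \<Longrightarrow> G \<le> F \<Longrightarrow> weak_lim X l G"
  by (auto simp: weak_lim_def intro: tendsto_mono)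

lemma tendsto_imp_weak_lim: "(X \<longlongrightarrow> l) F \<Longrightarrow> weak_lim X l F"
  by (auto simp: weak_lim_def intro: tendsto_intros)

lemma weak_lim_add: "weak_lim X l F \<Longrightarrow> weak_lim Y m F \<Longrightarrow> weak_lim (\<lambda>n. X n + Y n) (l + m) F"
  by (auto simp: weak_lim_def inner_add_left intro: tendsto_add)

lemma weak_lim_Pair: "weak_lim X l F \<Longrightarrow> weak_lim Y m F \<Longrightarrow> weak_lim (\<lambda>n. (X n, Y n)) (l, m) F"
  by (auto simp: weak_lim_def intro: tendsto_add)

lemma weak_lim_PairD:
  assumes "weak_lim X l F"
  shows "weak_lim (\<lambda>n. fst (X n)) (fst l) F" "weak_lim (\<lambda>n. snd (X n)) (snd l) F"
  using weak_limD[OF assms, of "(y, 0)" for y] weak_limD[OF assms, of "(0, y)" for y]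
  by (auto simp: weak_lim_def inner_prod_def)

lemma weak_lim_real: "weak_lim X l F \<Longrightarrow> (X \<longlongrightarrow> l) F" for l :: real
  using weak_limD[of X l F 1] by simp

text \<open>The projection \<open>p\<close> of the weak limit \<open>x\<close> to \<open>C\<close> satisfies \<open>(x - p) \<bullet> (c - p) \<le> 0\<close> for all
  \<open>c \<in> C\<close>, an inequality that passes to the weak limit and gives \<open>\<parallel>x - p\<parallel>\<^sup>2 \<le> 0\<close>.\<close>

lemma convex_closed_weakly_closed:
  fixes C :: "'a::{real_inner, complete_space} set"
  assumes "closed C" "convex C" "eventually (\<lambda>n. X n \<in> C) F" "weak_lim X x F" "F \<noteq> bot"
  shows "x \<in> C"
proof -
  have "C \<noteq> {}" using assms(3,5) by (auto simp: eventually_False)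
  then obtain p where p: "p \<in> C" "\<And>y. y \<in> C \<Longrightarrow> (x - p) \<bullet> (y - p) \<le> 0"
    using convex_projection_exists[OF assms(1,2)] by blast
  have "((\<lambda>n. X n \<bullet> (x - p) - p \<bullet> (x - p)) \<longlongrightarrow> x \<bullet> (x - p) - p \<bullet> (x - p)) F"
    by (intro tendsto_intros weak_limD assms)
  moreover have "eventually (\<lambda>n. X n \<bullet> (x - p) - p \<bullet> (x - p) \<le> 0) F"
    using assms(3) by eventually_elim (use p(2)[of "X _"] in \<open>simp add: algebra_simps inner_commute\<close>)
  ultimately have "x \<bullet> (x - p) - p \<bullet> (x - p) \<le> 0"
    using assms(5) tendsto_upperbound by blast
  then have "(x - p) \<bullet> (x - p) \<le> 0" by (simp add: inner_diff_left)
  then show ?thesis using p(1) by (metis inner_gt_zero_iff eq_iff_diff_eq_0 not_le)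
qed

text \<open>Banach--Alaoglu along filters: the coordinates \<open>y \<mapsto> X n \<bullet> y\<close> live in a product of compact
  intervals, so they cluster pointwise; the limit is a bounded linear functional, represented by a
  vector.\<close>

lemma bounded_imp_weak_cluster:
  fixes X :: "'i \<Rightarrow> 'a::{real_inner, complete_space}"
  assumes F: "F \<noteq> bot" and bd: "\<And>n. norm (X n) \<le> K"
  shows "\<exists>G l. G \<le> F \<and> G \<noteq> bot \<and> weak_lim X l G"
proof -
  define T where "T = (\<Pi>\<^sub>E y\<in>(UNIV::'a set). {- (K * norm y) .. K * norm y})"
  define c where "c n = (\<lambda>y. X n \<bullet> y)" for n
  have abs_c: "\<bar>c n y\<bar> \<le> K * norm y" for n y
    unfolding c_def using Cauchy_Schwarz_ineq2[of "X n" y] mult_right_mono[OF bd[of n], of "norm y"]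
    by simp
  have "compactin (product_topology (\<lambda>_. euclidean) UNIV) T"
    unfolding T_def by (auto simp: compactin_PiE)
  then have "compact T"
    by (simp add: euclidean_product_topology)
  moreover have "filtermap c F \<noteq> bot"
    using F by (simp add: filtermap_bot_iff)
  moreover have "eventually (\<lambda>x. x \<in> T) (filtermap c F)"
    using abs_c by (auto simp: eventually_filtermap T_def abs_le_iff minus_le_iff intro!: always_eventually)
  ultimately obtain \<phi> where \<phi>: "inf (nhds \<phi>) (filtermap c F) \<noteq> bot"
    unfolding compact_filter by blast
  \<comment> \<open>the coarsest refinement of \<open>F\<close> along which the coordinate functions converge to \<open>\<phi>\<close>\<close>
  define G where "G = inf F (filtercomap c (nhds \<phi>))"
  have G: "G \<noteq> bot"
  proof
    assume "G = bot"
    then obtain P Q where P: "eventually P F" and Q: "eventually Q (nhds \<phi>)"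
      and PQ: "\<And>n. P n \<Longrightarrow> Q (c n) \<Longrightarrow> False"
      unfolding trivial_limit_def eventually_inf G_def eventually_filtercomap by blast
    have "eventually (\<lambda>z. \<not> Q z) (filtermap c F)"
      using P by (auto simp: eventually_filtermap elim!: eventually_mono dest: PQ)
    with Q have "eventually (\<lambda>_. False) (inf (nhds \<phi>) (filtermap c F))"
      unfolding eventually_inf by blast
    with \<phi> show False by (simp add: trivial_limit_def)
  qed
  have "filterlim c (nhds \<phi>) G"
    unfolding G_def by (rule filterlim_mono[OF filterlim_filtercomap]) auto
  then have lim: "((\<lambda>n. X n \<bullet> y) \<longlongrightarrow> \<phi> y) G" for y
  proof (intro topological_tendstoI)
    fix U :: "real set" assume "open U" "\<phi> y \<in> U"
    moreover have "open ((\<lambda>f. f y) -` U :: ('a \<Rightarrow> real) set)"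
      using \<open>open U\<close> by (intro open_vimage continuous_on_product_coordinates)
    ultimately show "eventually (\<lambda>n. X n \<bullet> y \<in> U) G"
      using topological_tendstoD[OF \<open>filterlim c (nhds \<phi>) G\<close>, of "(\<lambda>f. f y) -` U"]
      by (simp add: c_def)
  qed
  have "bounded_linear \<phi>"
  proof (rule bounded_linear_intro)
    show "\<phi> (x + y) = \<phi> x + \<phi> y" for x y
      using tendsto_add[OF lim[of x] lim[of y]] lim[of "x + y"] G
      by (simp add: inner_add_right tendsto_unique)
    show "\<phi> (r *\<^sub>R x) = r *\<^sub>R \<phi> x" for r x
      using tendsto_mult[OF tendsto_const[of r] lim[of x]] lim[of "r *\<^sub>R x"] G
      by (simp add: tendsto_unique)
    show "norm (\<phi> y) \<le> norm y * K" for y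
      using abs_c[of _ y] G
      by (intro tendsto_upperbound[OF tendsto_norm[OF lim[of y]]] always_eventually)
        (auto simp: c_def mult.commute)
  qed
  then obtain l where "\<And>y. \<phi> y = l \<bullet> y" using riesz_representation by blast
  with lim have "weak_lim X l G" by (simp add: weak_lim_def)
  moreover have "G \<le> F" by (simp add: G_def)
  ultimately show ?thesis using G by blast
qed

text \<open>The filter form of the subsequence principle.\<close>

lemma tendsto_if_subfilters_cluster:
  assumes "\<And>G. G \<le> F \<Longrightarrow> G \<noteq> bot \<Longrightarrow> \<exists>G'\<le>G. G' \<noteq> bot \<and> (X \<longlongrightarrow> l) G'"
  shows "(X \<longlongrightarrow> l) F"
proof (rule topological_tendstoI, rule ccontr)
  fix S assume S: "open S" "l \<in> S" "\<not> eventually (\<lambda>n. X n \<in> S) F"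
  define G where "G = inf F (principal {n. X n \<notin> S})"
  have "G \<noteq> bot"
    using S(3) by (simp add: G_def trivial_limit_def eventually_inf_principal)
  then obtain G' where G': "G' \<le> G" "G' \<noteq> bot" "(X \<longlongrightarrow> l) G'"
    using assms[of G] by (auto simp: G_def)
  have "eventually (\<lambda>n. X n \<notin> S) G'"
    by (rule filter_leD[OF G'(1)]) (simp add: G_def eventually_inf_principal)
  moreover have "eventually (\<lambda>n. X n \<in> S) G'"
    using G'(3) S by (blast dest: topological_tendstoD)
  ultimately have "eventually (\<lambda>n. False) G'" by eventually_elim simp
  with G'(2) show False by (simp add: trivial_limit_def)
qed

section \<open>Absence of a duality gap\<close>

text \<open>The integer multiples of the sets cover the space, so by Baire's theorem one of these multiples
  contains a ball around some point \<open>z\<close>.  A later set also contains a negative multiple of \<open>z\<close>, and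
  by convexity it contains a ball around the origin.\<close>

lemma absorbing_closed_convex_interior:
  fixes A :: "nat \<Rightarrow> 'b::{real_normed_vector, complete_space} set"
  assumes cl: "\<And>n. closed (A n)" and cvx: "\<And>n. convex (A n)" and mono: "\<And>m n. m \<le> n \<Longrightarrow> A m \<subseteq> A n"
    and absorb: "\<And>y. \<exists>t>0. \<exists>n. t *\<^sub>R y \<in> A n"
  shows "\<exists>n. 0 \<in> interior (A n)"
proof -
  define B where "B m n = {y. inverse (real (Suc m)) *\<^sub>R y \<in> A n}" for m n
  obtain n0 where n0: "0 \<in> A n0" using absorb[of 0] by auto
  have cover: "\<exists>m n. y \<in> B m n" for y
  proof -
    obtain t n where t: "0 < t" "t *\<^sub>R y \<in> A n" using absorb by blast
    obtain m where m: "inverse (real (Suc m)) < t" using reals_Archimedean[OF t(1)] by blast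
    define s where "s = inverse (real (Suc m)) / t"
    have s: "0 \<le> s" "s \<le> 1" "s * t = inverse (real (Suc m))"
      using t(1) m by (simp_all add: s_def del: of_nat_Suc)
    have "t *\<^sub>R y \<in> A (max n n0)" "0 \<in> A (max n n0)"
      using t(2) n0 mono[of n "max n n0"] mono[of n0 "max n n0"] by auto
    then have "s *\<^sub>R t *\<^sub>R y + (1 - s) *\<^sub>R 0 \<in> A (max n n0)"
      using s by (intro convexD[OF cvx]) auto
    then show ?thesis using s(3) by (auto simp: B_def)
  qed
  have clB: "closed (B m n)" for m n
  proof -
    have "B m n = (\<lambda>y. inverse (real (Suc m)) *\<^sub>R y) -` A n" by (auto simp: B_def)
    also have "closed \<dots>" by (intro closed_vimage cl continuous_intros)
    finally show ?thesis .
  qed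
  have "\<exists>m n. interior (B m n) \<noteq> {}"
  proof (rule ccontr)
    assume "\<nexists>m n. interior (B m n) \<noteq> {}"
    then have "euclidean interior_of \<Union>(range (case_prod B)) = {}"
      using clB by (intro Baire_category_alt) (auto simp: completely_metrizable_space_euclidean)
    moreover have "\<Union>(range (case_prod B)) = UNIV" using cover by auto
    ultimately show False by simp
  qed
  then obtain m n z e where e: "0 < e" and ball: "\<And>y. dist z y < e \<Longrightarrow> y \<in> B m n"
    by (meson ex_in_conv mem_interior mem_ball subsetD)
  obtain t n' where t: "0 < t" "t *\<^sub>R (- z) \<in> A n'" using absorb by blast
  define N where "N = max n n'"
  define M where "M = real (Suc m)"
  have M: "0 < M" by (simp add: M_def)
  have N: "A n \<subseteq> A N" "A n' \<subseteq> A N" using mono by (simp_all add: N_def)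
  have tM: "0 < 1 + t * M" using t(1) M by (simp add: add_pos_pos)
  \<comment> \<open>The weights \<open>t M / (1 + t M)\<close> and \<open>1 / (1 + t M)\<close> make \<open>z\<close> cancel in the convex combination of
    \<open>(z + v) / M\<close> and \<open>- t z\<close>.\<close>
  have "y \<in> A N" if y: "norm y < e * t / (1 + t * M)" for y
  proof -
    define v where "v = ((1 + t * M) / t) *\<^sub>R y"
    have "norm v < e"
      using y t(1) tM by (simp add: v_def field_simps)
    then have "inverse M *\<^sub>R (z + v) \<in> A N"
      using ball[of "z + v"] N by (auto simp: B_def M_def dist_norm)
    moreover have "t *\<^sub>R (- z) \<in> A N" using t N by auto
    ultimately have "(t * M / (1 + t * M)) *\<^sub>R inverse M *\<^sub>R (z + v) + (1 / (1 + t * M)) *\<^sub>R t *\<^sub>R (- z) \<in> A N"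
      using t(1) M tM by (intro convexD[OF cvx]) (auto simp: field_simps)
    also have "(t * M / (1 + t * M)) *\<^sub>R inverse M *\<^sub>R (z + v) + (1 / (1 + t * M)) *\<^sub>R t *\<^sub>R (- z) = y"
      using t(1) M tM by (simp add: v_def scaleR_add_right)
    finally show ?thesis .
  qed
  then have "ball 0 (e * t / (1 + t * M)) \<subseteq> A N" by auto
  moreover have "0 < e * t / (1 + t * M)" using e t(1) tM by simp
  ultimately show ?thesis by (auto simp: mem_interior)
qed

text \<open>If \<open>X n + Y n \<in> D\<close> with \<open>X n \<in> C\<close> and \<open>Y n\<close> convergent, a weak cluster point of the bounded
  sequence \<open>X n\<close> lies in \<open>C\<close> and witnesses that the limit of \<open>Y n\<close> belongs to the set.\<close>

lemma closed_convex_difference: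
  fixes C D :: "'b::{real_inner, complete_space} set"
  assumes C: "closed C" "convex C" "bounded C" and D: "closed D" "convex D"
  shows "closed {y. \<exists>x\<in>C. x + y \<in> D}"
  unfolding closed_sequential_limits
proof (intro allI impI, elim conjE)
  fix Y l assume Y: "\<forall>n. Y n \<in> {y. \<exists>x\<in>C. x + y \<in> D}" and lim: "Y \<longlonglongrightarrow> l"
  then obtain X where X: "\<And>n. X n \<in> C" "\<And>n. X n + Y n \<in> D"
    by (auto simp: choice_iff Bex_def)
  obtain K where "\<And>x. x \<in> C \<Longrightarrow> norm x \<le> K" using C(3) by (auto simp: bounded_iff)
  then obtain G x where G: "G \<le> sequentially" "G \<noteq> bot" "weak_lim X x G"
    using bounded_imp_weak_cluster[of sequentially X K] X(1) by auto
  have "x \<in> C"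
    by (rule convex_closed_weakly_closed[OF C(1,2) _ G(3,2)]) (simp add: X)
  moreover have "weak_lim (\<lambda>n. X n + Y n) (x + l) G"
    by (intro weak_lim_add G tendsto_imp_weak_lim tendsto_mono[OF G(1) lim])
  then have "x + l \<in> D"
    by (rule convex_closed_weakly_closed[OF D, rotated]) (simp_all add: X G)
  ultimately show "l \<in> {y. \<exists>x\<in>C. x + y \<in> D}" by blast
qed

text \<open>The perturbation function \<open>y \<mapsto> inf {a + b | (x, a) \<in> E, (x + y, b) \<in> F}\<close> is bounded above near the
  origin.\<close>

definition perturbation_bounded :: "('b::real_normed_vector \<times> real) set \<Rightarrow> ('b \<times> real) set \<Rightarrow> bool" where
  "perturbation_bounded E F \<longleftrightarrow>
     (\<exists>r>0. \<exists>M. \<forall>y. norm y < r \<longrightarrow> (\<exists>x a b. (x, a) \<in> E \<and> (x + y, b) \<in> F \<and> a + b \<le> M))"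

text \<open>Bounding \<open>\<parallel>x\<parallel>\<close> and both function values by \<open>n\<close> gives an increasing family of sets of
  perturbations.  They are closed and convex, as differences of a closed convex and a bounded closed
  convex set, and under the interior condition they absorb the space, so one of them is a
  neighbourhood of the origin.\<close>

lemma interior_imp_perturbation_bounded:
  fixes E F :: "('b::{real_inner, complete_space} \<times> real) set"
  assumes E: "closed E" "convex E" and F: "closed F" "convex F"
    and upE: "\<And>x a a'. (x, a) \<in> E \<Longrightarrow> a \<le> a' \<Longrightarrow> (x, a') \<in> E"
    and upF: "\<And>x a a'. (x, a) \<in> F \<Longrightarrow> a \<le> a' \<Longrightarrow> (x, a') \<in> F"
    and int: "0 \<in> interior {x - y | x y. x \<in> fst ` E \<and> y \<in> fst ` F}"
  shows "perturbation_bounded E F"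
proof -
  define C where "C n = cball 0 (real n) \<inter> {x. (x, real n) \<in> E}" for n
  define D where "D n = {x. (x, real n) \<in> F}" for n
  define A where "A n = {y. \<exists>x\<in>C n. x + y \<in> D n}" for n
  have slice: "closed {x. (x, s) \<in> S}" "convex {x. (x, s) \<in> S}"
    if "closed S" "convex S" for S :: "('b \<times> real) set" and s
  proof -
    have "{x. (x, s) \<in> S} = (\<lambda>x. (x, s)) -` S" by auto
    also have "closed \<dots>" by (intro closed_vimage that continuous_intros)
    finally show "closed {x. (x, s) \<in> S}" .
    show "convex {x. (x, s) \<in> S}"
    proof (rule convexI)
      fix x y :: 'b and u v :: real
      assume *: "x \<in> {x. (x, s) \<in> S}" "y \<in> {x. (x, s) \<in> S}" "0 \<le> u" "0 \<le> v" "u + v = 1"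
      then have "u *\<^sub>R (x, s) + v *\<^sub>R (y, s) \<in> S" by (intro convexD[OF that(2)]) auto
      with *(5) show "u *\<^sub>R x + v *\<^sub>R y \<in> {x. (x, s) \<in> S}"
        by (simp flip: distrib_right)
    qed
  qed
  have C: "closed (C n)" "convex (C n)" "bounded (C n)" for n
    unfolding C_def by (auto intro!: closed_Int convex_Int slice E bounded_Int)
  have D: "closed (D n)" "convex (D n)" for n
    unfolding D_def by (auto intro!: slice F)
  have "\<exists>n. 0 \<in> interior (A n)"
  proof (rule absorbing_closed_convex_interior)
    show "closed (A n)" for n
      unfolding A_def by (rule closed_convex_difference[OF C D])
    show "convex (A n)" for n
    proof (rule convexI)
      fix y z :: 'b and u v :: real
      assume *: "y \<in> A n" "z \<in> A n" "0 \<le> u" "0 \<le> v" "u + v = 1"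
      then obtain x x' where x: "x \<in> C n" "x + y \<in> D n" "x' \<in> C n" "x' + z \<in> D n"
        by (auto simp: A_def)
      have "u *\<^sub>R x + v *\<^sub>R x' \<in> C n" "u *\<^sub>R (x + y) + v *\<^sub>R (x' + z) \<in> D n"
        using x * by (auto intro: convexD[OF C(2)] convexD[OF D(2)])
      then show "u *\<^sub>R y + v *\<^sub>R z \<in> A n"
        by (auto simp: A_def algebra_simps intro!: bexI[of _ "u *\<^sub>R x + v *\<^sub>R x'"])
    qed
    show "A m \<subseteq> A n" if "m \<le> n" for m n
      using that by (fastforce simp: A_def C_def D_def intro: upE upF)
    show "\<exists>t>0. \<exists>n. t *\<^sub>R y \<in> A n" for y
    proof -
      obtain e where e: "0 < e" "ball 0 e \<subseteq> {x - y | x y. x \<in> fst ` E \<and> y \<in> fst ` F}"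
        using int by (auto simp: mem_interior)
      define t where "t = e / (2 * (norm y + 1))"
      have t: "0 < t" using e(1) by (simp add: t_def add_nonneg_pos)
      have "norm (t *\<^sub>R y) < e"
      proof -
        have "norm (t *\<^sub>R y) = e * (norm y / (2 * (norm y + 1)))"
          using e(1) by (simp add: t_def add_nonneg_pos)
        also have "norm y / (2 * (norm y + 1)) < 1"
          using norm_ge_zero[of y] by (simp add: divide_less_eq_1) (smt (verit) norm_ge_zero)
        then have "e * (norm y / (2 * (norm y + 1))) < e * 1"
          using e(1) by (intro mult_strict_left_mono)
        finally show ?thesis by simp
      qed
      then have "- (t *\<^sub>R y) \<in> ball 0 e" by simp
      then obtain x a z b where *: "(x, a) \<in> E" "(z, b) \<in> F" "- (t *\<^sub>R y) = x - z"
        using e(2) by fastforce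
      obtain n where n: "norm x \<le> real n" "a \<le> real n" "b \<le> real n"
        using real_arch_simple[of "max (norm x) (max a b)"] by auto
      have "z = x + t *\<^sub>R y" using *(3) by (metis add_diff_cancel_left' diff_add_cancel minus_diff_eq neg_equal_iff_equal add.commute)
      with * n have "t *\<^sub>R y \<in> A n"
        by (auto simp: A_def C_def D_def intro!: bexI[of _ x] upE[of x a] upF[of _ b])
      with t show ?thesis by blast
    qed
  qed
  then obtain n r where r: "0 < r" "ball 0 r \<subseteq> A n" by (auto simp: mem_interior)
  have "\<exists>x a b. (x, a) \<in> E \<and> (x + y, b) \<in> F \<and> a + b \<le> 2 * real n" if "norm y < r" for y
  proof -
    have "y \<in> A n" using r(2) that by auto
    then obtain x where "(x, real n) \<in> E" "(x + y, real n) \<in> F"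
      by (auto simp: A_def C_def D_def)
    then show ?thesis by (intro exI[of _ x] exI[of _ "real n"]) simp
  qed
  with r(1) show ?thesis unfolding perturbation_bounded_def by blast
qed

text \<open>A convex function bounded above near the origin is lower semicontinuous
  there, so the point \<open>(0, v - e)\<close> below its graph is not in the closure of its epigraph \<open>V\<close>.  The
  projection to this closure gives a separating hyperplane.  It is not vertical, since the
  perturbation function is finite near the origin, and so its slope is an \<open>e\<close>-optimal dual point.\<close>

lemma approximate_dual_exists:
  fixes E F :: "('b::{real_inner, complete_space} \<times> real) set"
  assumes E: "convex E" and F: "convex F" and pb: "perturbation_bounded E F"
    and v: "\<And>x a b. (x, a) \<in> E \<Longrightarrow> (x, b) \<in> F \<Longrightarrow> v \<le> a + b" and e: "0 < e"
  shows "\<exists>p. \<forall>x a y b. (x, a) \<in> E \<longrightarrow> (y, b) \<in> F \<longrightarrow> v - e \<le> a + b + p \<bullet> (x - y)"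
proof -
  define V where "V = {(y, t). \<exists>x a b. (x, a) \<in> E \<and> (x + y, b) \<in> F \<and> a + b \<le> t}"
  obtain r M where r: "0 < r" and M: "\<And>y. norm y < r \<Longrightarrow> (y, M) \<in> V"
    using pb unfolding perturbation_bounded_def V_def by auto
  have up: "(y, t') \<in> V" if "(y, t) \<in> V" "t \<le> t'" for y t t'
    using that unfolding V_def by auto (meson order_trans)
  have V0: "v \<le> t" if "(0, t) \<in> V" for t
    using that v unfolding V_def by (fastforce dest: order_trans)
  have cvx: "convex V"
  proof (rule convexI)
    fix z z' :: "'b \<times> real" and s s' :: real
    assume z: "z \<in> V" "z' \<in> V" and s: "0 \<le> s" "0 \<le> s'" "s + s' = 1"
    obtain y t y' t' where zz: "z = (y, t)" "z' = (y', t')" by fastforce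
    obtain x a b where 1: "(x, a) \<in> E" "(x + y, b) \<in> F" "a + b \<le> t"
      using z(1) by (auto simp: zz V_def)
    obtain x' a' b' where 2: "(x', a') \<in> E" "(x' + y', b') \<in> F" "a' + b' \<le> t'"
      using z(2) by (auto simp: zz V_def)
    have "s *\<^sub>R (x, a) + s' *\<^sub>R (x', a') \<in> E" "s *\<^sub>R (x + y, b) + s' *\<^sub>R (x' + y', b') \<in> F"
      using 1 2 s by (auto intro: convexD[OF E] convexD[OF F] simp del: scaleR_Pair)
    moreover have "s * (a + b) + s' * (a' + b') \<le> s * t + s' * t'"
      using 1 2 s by (intro add_mono mult_left_mono) auto
    ultimately have "(s *\<^sub>R x + s' *\<^sub>R x', s * a + s' * a') \<in> E \<and>
        (s *\<^sub>R x + s' *\<^sub>R x' + (s *\<^sub>R y + s' *\<^sub>R y'), s * b + s' * b') \<in> F \<and>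
        (s * a + s' * a') + (s * b + s' * b') \<le> s * t + s' * t'"
      by (simp add: algebra_simps)
    then show "s *\<^sub>R z + s' *\<^sub>R z' \<in> V"
      unfolding zz V_def scaleR_Pair add_Pair mem_Collect_eq prod.case real_scaleR_def by blast
  qed
  have notin: "(0, v - e) \<notin> closure V"
  proof
    assume "(0, v - e) \<in> closure V"
    \<comment> \<open>The origin lies between a point \<open>y\<close> near it, where the value is below \<open>v - e/2\<close>, and \<open>- s y\<close>, where
      the value is at most \<open>M\<close>.  For this \<open>s\<close> convexity forces a value below \<open>v\<close> at the origin.\<close>
    define s where "s = 2 * (\<bar>M - v\<bar> + 1) / e"
    have s: "0 < s"
      unfolding s_def using e by (intro divide_pos_pos mult_pos_pos add_nonneg_pos) auto
    have "0 < min (e / 2) (r / s)" using e r s by simp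
    then obtain y t where yt: "(y, t) \<in> V" "dist (y, t) (0, v - e) < min (e / 2) (r / s)"
      using \<open>(0, v - e) \<in> closure V\<close> unfolding closure_approachable by (metis surj_pair)
    have "norm y < r / s" "\<bar>t - (v - e)\<bar> < e / 2"
      using yt(2) dist_fst_le[of "(y, t)" "(0, v - e)"] dist_snd_le[of "(y, t)" "(0, v - e)"]
      by (auto simp: dist_real_def)
    then have "norm ((- s) *\<^sub>R y) < r" and t: "e / 2 < v - t"
      using s by (simp add: field_simps, linarith)
    from M[OF this(1)] yt(1) have "(s / (1 + s)) *\<^sub>R (y, t) + (1 / (1 + s)) *\<^sub>R ((- s) *\<^sub>R y, M) \<in> V"
      using s by (intro convexD[OF cvx]) (auto simp: field_simps)
    then have "(0, (s * t + M) / (1 + s)) \<in> V"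
      by (simp add: add_divide_distrib)
    from V0[OF this] have "s * (v - t) \<le> M - v"
      using s by (simp add: field_simps)
    moreover have "s * (e / 2) < s * (v - t)" using s t by (intro mult_strict_left_mono)
    moreover have "s * (e / 2) = \<bar>M - v\<bar> + 1" using e by (simp add: s_def)
    ultimately show False by linarith
  qed
  have "V \<noteq> {}" using M[of 0] r by auto
  then obtain z where z: "z \<in> closure V" "\<And>w. w \<in> closure V \<Longrightarrow> ((0, v - e) - z) \<bullet> (w - z) \<le> 0"
    using convex_projection_exists[of "closure V" "(0, v - e)"] cvx by (auto simp: convex_closure)
  define q where "q = - fst z"
  define \<sigma> where "\<sigma> = v - e - snd z"
  have ne: "(q, \<sigma>) \<noteq> 0"
    using notin z(1) by (cases z) (auto simp: q_def \<sigma>_def zero_prod_def)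
  \<comment> \<open>the projection inequality, written with the separating functional \<open>(q, \<sigma>)\<close>\<close>
  have sep: "q \<bullet> y + q \<bullet> q + \<sigma> * \<sigma> + \<sigma> * (t - (v - e)) \<le> 0" if "(y, t) \<in> V" for y t
    using z(2)[of "(y, t)"] closure_subset[of V] that
    by (cases z) (auto simp: q_def \<sigma>_def algebra_simps)
  have "\<sigma> \<le> 0"
  proof (rule ccontr)
    assume "\<not> \<sigma> \<le> 0"
    then have "0 < \<sigma>" by simp
    have "(0, max M (v - e)) \<in> V" using up[OF M[of 0]] r by simp
    from sep[OF this] have "\<sigma> * \<sigma> + \<sigma> * (max M (v - e) - (v - e)) \<le> 0"
      by (simp add: add.commute add.left_commute) (smt (verit) inner_ge_zero)
    moreover have "0 < \<sigma> * \<sigma>" "0 \<le> \<sigma> * (max M (v - e) - (v - e))"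
      using \<open>0 < \<sigma>\<close> by auto
    ultimately show False by linarith
  qed
  moreover have "\<sigma> \<noteq> 0"
  proof
    assume "\<sigma> = 0"
    then have "q \<bullet> q \<le> 0" using sep[OF M[of 0]] r by simp
    then have "q = 0" by (metis inner_gt_zero_iff not_le)
    with ne \<open>\<sigma> = 0\<close> show False by (simp add: zero_prod_def)
  qed
  ultimately have \<sigma>: "\<sigma> < 0" by simp
  have "v - e \<le> a + b + (- inverse \<sigma> *\<^sub>R q) \<bullet> (x - y)" if "(x, a) \<in> E" "(y, b) \<in> F" for x a y b
  proof -
    have "(y - x, a + b) \<in> V" using that unfolding V_def by force
    from sep[OF this] have "q \<bullet> (y - x) + \<sigma> * (a + b - (v - e)) \<le> 0"
      by (smt (verit) inner_ge_zero zero_le_square)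
    then have "0 \<le> inverse \<sigma> * (q \<bullet> (y - x) + \<sigma> * (a + b - (v - e)))"
      using \<sigma> by (simp add: mult_nonpos_nonpos)
    also have "\<dots> = inverse \<sigma> * (q \<bullet> (y - x)) + (a + b - (v - e))"
      using \<sigma> by (simp add: distrib_left)
    finally show ?thesis by (simp add: inner_diff_right algebra_simps)
  qed
  then show ?thesis by blast
qed

text \<open>\<open>A\<close> and \<open>B\<close> bound the two conjugates occurring in the dual objective.  The two Fenchel--Young
  inequalities at \<open>w\<close> add up to \<open>-(a + b) \<le> A + B\<close>, so without a gap both are equations, which means
  that \<open>-p\<close> and \<open>p\<close> are subgradients.\<close>

lemma zero_gap_imp_subgrad:
  assumes A: "\<And>x a. (x, a) \<in> E \<Longrightarrow> - (p \<bullet> x) - a \<le> A"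
    and B: "\<And>x b. (x, b) \<in> F \<Longrightarrow> p \<bullet> x - b \<le> B"
    and gap: "A + B \<le> - (a + b)" and in_EF: "(w, a) \<in> E" "(w, b) \<in> F"
  shows "subgrad E (- p) w a" "subgrad F p w b"
proof -
  show "subgrad E (- p) w a"
  proof (rule subgradI[OF in_EF(1)])
    fix y t assume "(y, t) \<in> E"
    then show "a + - p \<bullet> (y - w) \<le> t"
      using A[of y t] B[OF in_EF(2)] gap by (simp add: inner_diff_right)
  qed
  show "subgrad F p w b"
  proof (rule subgradI[OF in_EF(2)])
    fix y t assume "(y, t) \<in> F"
    then show "b + p \<bullet> (y - w) \<le> t"
      using A[OF in_EF(1)] B[of y t] gap by (simp add: inner_diff_right)
  qed
qed

section \<open>Weak convergence of the iteration\<close>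

definition saddle_point :: "('b::real_inner \<times> real) set \<Rightarrow> ('b \<times> real) set \<Rightarrow> 'b \<Rightarrow> 'b \<Rightarrow> bool" where
  "saddle_point E F p x \<longleftrightarrow> (\<exists>a b. subgrad E (- p) x a \<and> subgrad F p x b)"

lemma subgrad_monotone_scaled:
  assumes "subgrad E (l *\<^sub>R p) x a" "subgrad E (l *\<^sub>R q) y b" "0 < l"
  shows "(p - q) \<bullet> (x - y) \<ge> 0"
  using subgrad_monotone[OF assms(1,2)] assms(3)
  by (simp add: zero_le_mult_iff flip: scaleR_diff_right)

lemma abs_inner_le:
  fixes u v :: "'b::real_inner"
  assumes "norm u \<le> A" "norm v \<le> B"
  shows "\<bar>u \<bullet> v\<bar> \<le> A * B"
proof -
  have "0 \<le> A" using assms(1) norm_ge_zero order_trans by blast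
  then have "norm u * norm v \<le> A * B" using assms by (intro mult_mono) auto
  then show ?thesis using Cauchy_Schwarz_ineq2[of u v] by linarith
qed

lemma tendsto_inner_null_bounded:
  fixes u v :: "'i \<Rightarrow> 'b::real_inner"
  assumes "(u \<longlongrightarrow> 0) F" "\<And>n. norm (v n) \<le> K"
  shows "((\<lambda>n. u n \<bullet> v n) \<longlongrightarrow> 0) F"
proof (rule Lim_null_comparison)
  show "eventually (\<lambda>n. norm (u n \<bullet> v n) \<le> norm (u n) * K) F"
    using assms(2) by (auto intro!: always_eventually abs_inner_le)
  show "((\<lambda>n. norm (u n) * K) \<longlongrightarrow> 0) F"
    using tendsto_mult_left_zero[OF tendsto_norm_zero[OF assms(1)]] .
qed

text \<open>The sets \<open>E\<close> and \<open>F\<close> are the epigraphs of two functions \<open>h\<close> and \<open>f\<close> on the same space.  The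
  assumptions \<open>sg_E\<close> and \<open>sg_F\<close> are the optimality conditions of two successive proximal steps: \<open>w k\<close> is
  computed from \<open>b k\<close> and \<open>d k\<close>, and \<open>b k\<close>, \<open>d k\<close> are the result of the preceding step for \<open>f\<close>.  An
  iteration with arbitrary initial data therefore fits in only after its first step.\<close>

locale douglas_rachford =
  fixes E F :: "('b::{real_inner, complete_space} \<times> real) set" and l :: real
    and b d w :: "nat \<Rightarrow> 'b" and \<alpha> \<beta> :: "nat \<Rightarrow> real"
  assumes closed_E: "closed E" and convex_E: "convex E"
    and closed_F: "closed F" and convex_F: "convex F"
    and l_pos: "0 < l"
    and sg_F: "\<And>k. subgrad F (l *\<^sub>R b k) (d k) (\<beta> k)"
    and sg_E: "\<And>k. subgrad E (l *\<^sub>R (- (b k + w k - d k))) (w k) (\<alpha> k)"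
    and step: "\<And>k. b (Suc k) + d (Suc k) = b k + w k"
    and saddle_exists: "\<exists>p x. saddle_point E F (l *\<^sub>R p) x"
begin

definition z :: "nat \<Rightarrow> 'b" where
  "z k = b k + d k"

text \<open>Adding the monotonicity inequalities for the subgradients of \<open>h\<close> and \<open>f\<close>, taken at the iterates
  and at the saddle point, gives \<open>(z k - (p + x)) \<bullet> r + \<parallel>r\<parallel>\<^sup>2 \<le> 0\<close> for \<open>r = w k - d k = z (k+1) - z k\<close>.\<close>

lemma fejer_inequality:
  assumes "saddle_point E F (l *\<^sub>R p) x"
  shows "(norm (z (Suc k) - (p + x)))\<^sup>2 + (norm (d k - w k))\<^sup>2 \<le> (norm (z k - (p + x)))\<^sup>2"
proof -
  obtain s t where st: "subgrad E (l *\<^sub>R (- p)) x s" "subgrad F (l *\<^sub>R p) x t"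
    using assms by (auto simp: saddle_point_def)
  have "0 \<le> (b k - p) \<bullet> (d k - x)"
    by (rule subgrad_monotone_scaled[OF sg_F st(2) l_pos])
  moreover have "0 \<le> (- (b k + w k - d k) - (- p)) \<bullet> (w k - x)"
    by (rule subgrad_monotone_scaled[OF sg_E st(1) l_pos])
  ultimately show ?thesis
    unfolding z_def step by (simp add: power2_norm_eq_inner algebra_simps inner_commute)
qed

lemma fejer_decseq:
  assumes "saddle_point E F (l *\<^sub>R p) x"
  shows "decseq (\<lambda>k. (norm (z k - (p + x)))\<^sup>2)"
proof (rule decseq_SucI)
  show "(norm (z (Suc k) - (p + x)))\<^sup>2 \<le> (norm (z k - (p + x)))\<^sup>2" for k
    using fejer_inequality[OF assms, of k] zero_le_power2[of "norm (d k - w k)"] by linarith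
qed

lemma summable_residuals: "summable (\<lambda>k. (norm (d k - w k))\<^sup>2)"
proof -
  obtain p x where px: "saddle_point E F (l *\<^sub>R p) x" using saddle_exists by blast
  have "(\<Sum>k<n. (norm (d k - w k))\<^sup>2) \<le> (norm (z 0 - (p + x)))\<^sup>2 - (norm (z n - (p + x)))\<^sup>2" for n
  proof (induction n)
    case (Suc n)
    then show ?case using fejer_inequality[OF px, of n] by simp
  qed simp
  then have "(\<Sum>k<n. (norm (d k - w k))\<^sup>2) \<le> (norm (z 0 - (p + x)))\<^sup>2" for n
    by (rule order_trans) simp
  then show ?thesis by (intro summableI_nonneg_bounded) auto
qed

lemma residuals_tendsto_0: "(\<lambda>k. w k - d k) \<longlonglongrightarrow> 0"
proof -
  have "(\<lambda>k. sqrt ((norm (d k - w k))\<^sup>2)) \<longlonglongrightarrow> sqrt 0"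
    by (intro tendsto_real_sqrt summable_LIMSEQ_zero summable_residuals)
  then have "(\<lambda>k. norm (w k - d k)) \<longlonglongrightarrow> 0" by (simp add: norm_minus_commute)
  then show ?thesis by (rule tendsto_norm_zero_cancel)
qed

text \<open>The Fejer inequality bounds only the sums \<open>b k + d k\<close>.  Monotonicity of the subgradients of \<open>f\<close> makes
  \<open>b k - p\<close> and \<open>d k - x\<close> form an acute angle, so each of them is at most as long as their sum.\<close>

lemma iterates_bounded:
  "\<exists>K. \<forall>k. norm (b k) \<le> K \<and> norm (d k) \<le> K \<and> norm (w k) \<le> K"
proof -
  obtain p x where px: "saddle_point E F (l *\<^sub>R p) x" using saddle_exists by blast
  then obtain t where t: "subgrad F (l *\<^sub>R p) x t" by (auto simp: saddle_point_def)
  define R where "R = norm (z 0 - (p + x))"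
  have zR: "(norm (z k - (p + x)))\<^sup>2 \<le> R\<^sup>2" for k
    using decseqD[OF fejer_decseq[OF px], of 0 k] by (simp add: R_def)
  have split: "(norm (z k - (p + x)))\<^sup>2 \<ge> (norm (b k - p))\<^sup>2 + (norm (d k - x))\<^sup>2" for k
    using subgrad_monotone_scaled[OF sg_F[of k] t l_pos]
    by (simp add: z_def power2_norm_eq_inner algebra_simps inner_commute)
  have R: "0 \<le> R" by (simp add: R_def)
  have "norm (b k - p) \<le> R" "norm (d k - x) \<le> R" for k
    using zR[of k] split[of k] zero_le_power2[of "norm (b k - p)"] zero_le_power2[of "norm (d k - x)"]
    by (intro power2_le_imp_le[OF _ R]; linarith)+
  then have bd: "norm (b k) \<le> R + norm p" "norm (d k) \<le> R + norm x" for k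
    by (smt (verit) norm_triangle_sub)+
  have "norm (w k) \<le> 3 * R + 2 * norm p + norm x" for k
  proof -
    have "w k = b (Suc k) + d (Suc k) - b k" using step[of k] by simp
    then have "norm (w k) \<le> norm (b (Suc k)) + norm (d (Suc k)) + norm (b k)"
      by (smt (verit) norm_triangle_ineq norm_triangle_ineq4)
    then show ?thesis using bd[of k] bd[of "Suc k"] by linarith
  qed
  moreover have "norm (b k) \<le> 3 * R + 2 * norm p + norm x" for k
    using bd(1)[of k] R norm_ge_zero[of p] norm_ge_zero[of x] by linarith
  moreover have "norm (d k) \<le> 3 * R + 2 * norm p + norm x" for k
    using bd(2)[of k] R norm_ge_zero[of p] by linarith
  ultimately show ?thesis by blast
qed

text \<open>The subgradients at the saddle point bound the function values from below, and the subgradients at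
  the iterates bound them from above.\<close>

lemma values_bounded:
  "\<exists>K. \<forall>k. \<bar>\<alpha> k\<bar> \<le> K \<and> \<bar>\<beta> k\<bar> \<le> K"
proof -
  obtain p x s t where st: "subgrad E (- (l *\<^sub>R p)) x s" "subgrad F (l *\<^sub>R p) x t"
    using saddle_exists by (auto simp: saddle_point_def)
  obtain K where K: "\<And>k. norm (b k) \<le> K" "\<And>k. norm (d k) \<le> K" "\<And>k. norm (w k) \<le> K"
    using iterates_bounded by auto
  have K0: "0 \<le> K" using norm_ge_zero order_trans K(1) by blast
  define A where "A = norm p + 3 * K"
  define B where "B = norm x + K"
  have inner: "\<bar>l * (u \<bullet> v)\<bar> \<le> l * (A * B)" if "norm u \<le> A" "norm v \<le> B" for u v :: 'b
    using abs_inner_le[OF that] l_pos by (simp add: abs_mult)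
  have bA: "norm (b k) \<le> A" and pA: "norm p \<le> A" and rA: "norm (b k + w k - d k) \<le> A" for k
  proof -
    show "norm (b k) \<le> A" "norm p \<le> A" using K(1)[of k] K0 norm_ge_zero[of p] unfolding A_def by linarith+
    have "norm (b k + w k - d k) \<le> norm (b k) + norm (w k) + norm (d k)"
      by (smt (verit) norm_triangle_ineq norm_triangle_ineq4)
    then show "norm (b k + w k - d k) \<le> A"
      using K[of k] norm_ge_zero[of p] unfolding A_def by linarith
  qed
  have dB: "norm (d k - x) \<le> B" "norm (x - d k) \<le> B" and wB: "norm (w k - x) \<le> B" "norm (x - w k) \<le> B" for k
    using norm_triangle_ineq4[of x "d k"] norm_triangle_ineq4[of x "w k"] K[of k]
    unfolding B_def by (simp_all add: norm_minus_commute)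
  have "\<bar>\<beta> k\<bar> \<le> \<bar>s\<bar> + \<bar>t\<bar> + l * (A * B)" for k
    using subgrad_le[OF sg_F subgrad_in[OF st(2)], of k] subgrad_le[OF st(2) subgrad_in[OF sg_F], of k]
      inner[OF bA dB(2), of k k] inner[OF pA dB(1), of k]
    by (simp add: abs_le_iff) linarith
  moreover have "\<bar>\<alpha> k\<bar> \<le> \<bar>s\<bar> + \<bar>t\<bar> + l * (A * B)" for k
    using subgrad_le[OF sg_E subgrad_in[OF st(1)], of k] subgrad_le[OF st(1) subgrad_in[OF sg_E], of k]
      inner[OF rA wB(2), of k k] inner[OF pA wB(1), of k]
    unfolding inner_scaleR_left inner_minus_left mult_minus_right by linarith
  ultimately show ?thesis by blast
qed

text \<open>Since \<open>b k\<close> and \<open>d k\<close> converge only weakly, the limit of \<open>b k \<bullet> d k\<close> is not under control and a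
  single subgradient inequality does not pass to the limit.  In the sum of both, however, the product
  occurs only in the combination \<open>b k \<bullet> (w k - d k)\<close>, which tends to zero.  Inserting the limit point itself
  for one of the two free arguments of the limiting inequality separates it again.\<close>

lemma weak_cluster_saddle:
  assumes G: "G \<le> sequentially" "G \<noteq> bot" and lim: "weak_lim b p G" "weak_lim d x G"
  shows "saddle_point E F (l *\<^sub>R p) x"
proof -
  obtain K where K: "\<And>k. \<bar>\<alpha> k\<bar> \<le> K" "\<And>k. \<bar>\<beta> k\<bar> \<le> K"
    using values_bounded by auto
  have "norm (\<alpha> k, \<beta> k) \<le> K + K" for k
    using norm_Pair_le[of "\<alpha> k" "\<beta> k"] K[of k] by simp
  then obtain H c where H: "H \<le> G" "H \<noteq> bot" "weak_lim (\<lambda>k. (\<alpha> k, \<beta> k)) c H"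
    using bounded_imp_weak_cluster[OF G(2), of "\<lambda>k. (\<alpha> k, \<beta> k)" "K + K"] by blast
  define s where "s = fst c"
  define t where "t = snd c"
  have \<alpha>: "(\<alpha> \<longlongrightarrow> s) H" and \<beta>: "(\<beta> \<longlongrightarrow> t) H"
    using weak_lim_PairD[OF H(3)] by (auto simp: s_def t_def intro: weak_lim_real)
  have r: "((\<lambda>k. w k - d k) \<longlongrightarrow> 0) H"
    using residuals_tendsto_0 tendsto_mono[OF order_trans[OF H(1) G(1)]] by blast
  have b: "weak_lim b p H" and d: "weak_lim d x H"
    using lim weak_lim_mono[OF _ H(1)] by blast+
  have w: "weak_lim w x H"
    using weak_lim_add[OF d tendsto_imp_weak_lim[OF r]] by simp
  have xsE: "(x, s) \<in> E"
    by (rule convex_closed_weakly_closed[OF closed_E convex_E _ weak_lim_Pair[OF w tendsto_imp_weak_lim[OF \<alpha>]] H(2)])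
      (simp add: subgrad_in[OF sg_E])
  have xtF: "(x, t) \<in> F"
    by (rule convex_closed_weakly_closed[OF closed_F convex_F _ weak_lim_Pair[OF d tendsto_imp_weak_lim[OF \<beta>]] H(2)])
      (simp add: subgrad_in[OF sg_F])
  obtain K' where K': "\<And>k. norm (b k) \<le> K'" "\<And>k. norm (d k) \<le> K'" "\<And>k. norm (w k) \<le> K'"
    using iterates_bounded by auto
  have ineq: "s + t + l * (p \<bullet> (y - v)) \<le> e + f" if yv: "(v, e) \<in> E" "(y, f) \<in> F" for y v e f
  proof -
    let ?r = "\<lambda>k. w k - d k"
    have "norm (v - w k) \<le> norm v + K'" for k
      using norm_triangle_ineq4[of v "w k"] K'(3)[of k] by linarith
    then have "((\<lambda>k. ?r k \<bullet> (v - w k)) \<longlongrightarrow> 0) H"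
      by (rule tendsto_inner_null_bounded[OF r])
    moreover have "((\<lambda>k. ?r k \<bullet> b k) \<longlongrightarrow> 0) H"
      by (rule tendsto_inner_null_bounded[OF r K'(1)])
    ultimately have lim: "((\<lambda>k. \<alpha> k + \<beta> k + l * (b k \<bullet> (y - v) + ?r k \<bullet> b k - ?r k \<bullet> (v - w k)))
        \<longlongrightarrow> s + t + l * (p \<bullet> (y - v) + 0 - 0)) H"
      by (intro tendsto_intros \<alpha> \<beta> weak_limD[OF b])
    have le: "\<alpha> k + \<beta> k + l * (b k \<bullet> (y - v) + ?r k \<bullet> b k - ?r k \<bullet> (v - w k)) \<le> e + f" for k
      using subgrad_le[OF sg_E yv(1), of k] subgrad_le[OF sg_F yv(2), of k]
      by (simp add: algebra_simps inner_commute)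
    have "s + t + l * (p \<bullet> (y - v) + 0 - 0) \<le> e + f"
      by (rule tendsto_upperbound[OF lim _ H(2)]) (simp only: le eventually_True)
    then show ?thesis by simp
  qed
  have "subgrad E (- (l *\<^sub>R p)) x s"
  proof (rule subgradI[OF xsE])
    fix v e assume "(v, e) \<in> E"
    from ineq[OF this xtF] show "s + - (l *\<^sub>R p) \<bullet> (v - x) \<le> e"
      by (simp add: algebra_simps)
  qed
  moreover have "subgrad F (l *\<^sub>R p) x t"
  proof (rule subgradI[OF xtF])
    fix y f assume "(y, f) \<in> F"
    from ineq[OF xsE this] show "t + (l *\<^sub>R p) \<bullet> (y - x) \<le> f"
      by simp
  qed
  ultimately show ?thesis unfolding saddle_point_def by blast
qed

text \<open>Opial's argument: the distances of \<open>z k\<close> to \<open>p + x\<close> and to \<open>q + y\<close> converge, hence so does the inner product of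
  \<open>z k\<close> with the difference of these two points.  Both cluster points assign to it the same
  limit, so \<open>p + x = q + y\<close>.  The sum determines its summands because \<open>x\<close> is the proximal point of
  \<open>p + x\<close> with respect to \<open>f\<close>.\<close>

lemma weak_cluster_unique:
  assumes G: "G \<le> sequentially" "G \<noteq> bot" "weak_lim b p G" "weak_lim d x G"
    and H: "H \<le> sequentially" "H \<noteq> bot" "weak_lim b q H" "weak_lim d y H"
  shows "p = q \<and> x = y"
proof -
  have px: "saddle_point E F (l *\<^sub>R p) x" and qy: "saddle_point E F (l *\<^sub>R q) y"
    using weak_cluster_saddle[OF G] weak_cluster_saddle[OF H] .
  let ?D = "(p + x) - (q + y)"
  have conv: "convergent (\<lambda>k. (norm (z k - (p' + x')))\<^sup>2)" if "saddle_point E F (l *\<^sub>R p') x'" for p' x'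
    using decseq_convergent[OF fejer_decseq[OF that], of 0] by (auto simp: convergent_def)
  then obtain c1 c2 where "(\<lambda>k. (norm (z k - (p + x)))\<^sup>2) \<longlonglongrightarrow> c1" "(\<lambda>k. (norm (z k - (q + y)))\<^sup>2) \<longlonglongrightarrow> c2"
    using px qy unfolding convergent_def by blast
  then have "(\<lambda>k. (norm (z k - (q + y)))\<^sup>2 - (norm (z k - (p + x)))\<^sup>2 + ((norm (p + x))\<^sup>2 - (norm (q + y))\<^sup>2))
      \<longlonglongrightarrow> c2 - c1 + ((norm (p + x))\<^sup>2 - (norm (q + y))\<^sup>2)"
    by (intro tendsto_intros)
  moreover have "(norm (z k - (q + y)))\<^sup>2 - (norm (z k - (p + x)))\<^sup>2 + ((norm (p + x))\<^sup>2 - (norm (q + y))\<^sup>2)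
      = 2 * (z k \<bullet> ?D)" for k
    by (simp add: power2_norm_eq_inner algebra_simps inner_commute)
  ultimately have "(\<lambda>k. 1 / 2 * (2 * (z k \<bullet> ?D))) \<longlonglongrightarrow> 1 / 2 * (c2 - c1 + ((norm (p + x))\<^sup>2 - (norm (q + y))\<^sup>2))"
    by (intro tendsto_mult_left) simp
  then obtain c where c: "(\<lambda>k. z k \<bullet> ?D) \<longlonglongrightarrow> c" by auto
  have "(p + x) \<bullet> ?D = c"
    using tendsto_unique[OF G(2) weak_limD[OF weak_lim_add[OF G(3,4)], of ?D] tendsto_mono[OF G(1) c[unfolded z_def]]] .
  moreover have "(q + y) \<bullet> ?D = c"
    using tendsto_unique[OF H(2) weak_limD[OF weak_lim_add[OF H(3,4)], of ?D] tendsto_mono[OF H(1) c[unfolded z_def]]] .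
  ultimately have "?D \<bullet> ?D = 0" by (simp only: inner_diff_left diff_self)
  then have "?D = 0" by (simp only: inner_eq_zero_iff)
  then have pq: "p - q = - (x - y)" by (simp add: algebra_simps)
  obtain s t where "subgrad F (l *\<^sub>R p) x s" "subgrad F (l *\<^sub>R q) y t"
    using px qy unfolding saddle_point_def by blast
  from subgrad_monotone_scaled[OF this l_pos] have "(x - y) \<bullet> (x - y) \<le> 0"
    unfolding pq inner_minus_left by simp
  then have "x = y" by (metis inner_gt_zero_iff eq_iff_diff_eq_0 not_le)
  with pq show ?thesis by simp
qed

lemma weak_convergence:
  "\<exists>p x. weak_lim b p sequentially \<and> weak_lim d x sequentially \<and> saddle_point E F (l *\<^sub>R p) x"
proof -
  obtain K where K: "\<And>k. norm (b k) \<le> K" "\<And>k. norm (d k) \<le> K" "\<And>k. norm (w k) \<le> K"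
    using iterates_bounded by auto
  have bd: "norm (b k, d k) \<le> K + K" for k
    using norm_Pair_le[of "b k" "d k"] K(1,2)[of k] by linarith
  have cluster: "\<exists>G p x. G \<le> H \<and> G \<noteq> bot \<and> weak_lim b p G \<and> weak_lim d x G" if H: "H \<noteq> bot" for H
  proof -
    have "\<exists>G c. G \<le> H \<and> G \<noteq> bot \<and> weak_lim (\<lambda>k. (b k, d k)) c G"
      by (rule bounded_imp_weak_cluster[OF H bd])
    then obtain G c where G: "G \<le> H" "G \<noteq> bot" "weak_lim (\<lambda>k. (b k, d k)) c G"
      by (elim exE conjE)
    have "weak_lim b (fst c) G" "weak_lim d (snd c) G"
      using weak_lim_PairD[OF G(3)] by simp_all
    with G(1,2) show ?thesis by (intro exI conjI)
  qed
  obtain G p x where G: "G \<le> sequentially" "G \<noteq> bot" "weak_lim b p G" "weak_lim d x G"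
    using cluster[OF sequentially_bot] by (elim exE conjE)
  have sub: "\<exists>G'\<le>H. G' \<noteq> bot \<and> weak_lim b p G' \<and> weak_lim d x G'" if H: "H \<le> sequentially" "H \<noteq> bot" for H
  proof -
    obtain G' p' x' where G': "G' \<le> H" "G' \<noteq> bot" "weak_lim b p' G'" "weak_lim d x' G'"
      using cluster[OF H(2)] by (elim exE conjE)
    moreover have "p = p' \<and> x = x'"
      using weak_cluster_unique[OF G order_trans[OF G'(1) H(1)] G'(2-4)] .
    ultimately show ?thesis by (intro exI[of _ G']) simp
  qed
  have "weak_lim b p sequentially"
    unfolding weak_lim_def
  proof (intro allI tendsto_if_subfilters_cluster)
    fix y and H :: "nat filter" assume "H \<le> sequentially" "H \<noteq> bot"
    from sub[OF this] show "\<exists>G'\<le>H. G' \<noteq> bot \<and> ((\<lambda>k. b k \<bullet> y) \<longlongrightarrow> p \<bullet> y) G'"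
      by (elim exE conjE) (intro exI conjI weak_limD)
  qed
  moreover have "weak_lim d x sequentially"
    unfolding weak_lim_def
  proof (intro allI tendsto_if_subfilters_cluster)
    fix y and H :: "nat filter" assume "H \<le> sequentially" "H \<noteq> bot"
    from sub[OF this] show "\<exists>G'\<le>H. G' \<noteq> bot \<and> ((\<lambda>k. d k \<bullet> y) \<longlongrightarrow> x \<bullet> y) G'"
      by (elim exE conjE) (intro exI conjI weak_limD)
  qed
  ultimately show ?thesis using weak_cluster_saddle[OF G] by blast
qed

end

section \<open>Epigraphs\<close>

definition epi :: "('a \<Rightarrow> ereal) \<Rightarrow> ('a \<times> real) set" where
  "epi f = {(x, a). f x \<le> ereal a}"

text \<open>For injective \<open>L\<close> this is the epigraph of the function that takes the value \<open>g u\<close> at \<open>L u\<close> and is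
  infinite outside the range of \<open>L\<close>.\<close>

definition epi_image :: "('a \<Rightarrow> 'b) \<Rightarrow> ('a \<Rightarrow> ereal) \<Rightarrow> ('b \<times> real) set" where
  "epi_image L g = (\<lambda>(u, a). (L u, a)) ` epi g"

lemma epi_image_id: "epi_image (\<lambda>x. x) f = epi f"
  by (simp add: epi_image_def)

lemma epi_imageI: "g u \<le> ereal a \<Longrightarrow> (L u, a) \<in> epi_image L g"
  by (auto simp: epi_image_def epi_def)

lemma epi_imageE:
  assumes "(x, a) \<in> epi_image L g"
  obtains u where "x = L u" "g u \<le> ereal a"
  using assms by (auto simp: epi_image_def epi_def)

lemma epi_image_upward: "(x, a) \<in> epi_image L g \<Longrightarrow> a \<le> a' \<Longrightarrow> (x, a') \<in> epi_image L g"
  by (force elim!: epi_imageE intro: epi_imageI order_trans)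

lemma fst_epi_image: "fst ` epi_image L g = L ` eff_dom g"
proof -
  have "(\<exists>a. g u \<le> ereal a) \<longleftrightarrow> g u < \<infinity>" for u
    by (cases "g u") auto
  then show ?thesis
    by (force simp: epi_image_def epi_def eff_dom_def image_iff)
qed

lemma closed_epi:
  assumes "lsc_fun f"
  shows "closed (epi f)"
proof -
  have "\<exists>U. open U \<and> z \<in> U \<and> U \<subseteq> - epi f" if "z \<in> - epi f" for z
  proof -
    obtain x a where z: "z = (x, a)" by fastforce
    with that have "ereal a < f x" by (simp add: epi_def)
    then obtain c where c: "ereal a < ereal c" "ereal c < f x"
      using ereal_dense2 by blast
    have "f x \<le> Liminf (at x) f" using assms by (simp add: lsc_fun_def)
    then have "eventually (\<lambda>y. ereal c < f y) (at x)"
      using c(2) unfolding le_Liminf_iff by blast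
    then obtain S where S: "open S" "x \<in> S" "\<And>y. y \<in> S \<Longrightarrow> y \<noteq> x \<Longrightarrow> ereal c < f y"
      unfolding eventually_at_topological by blast
    have "ereal s < f y" if "y \<in> S" "s < c" for y s
      using S(3)[OF that(1)] c(2) that(2) by (cases "y = x") (auto intro: less_trans[of _ "ereal c"])
    then have "S \<times> {..<c} \<subseteq> - epi f" by (fastforce simp: epi_def not_le)
    with S(1,2) c(1) z show ?thesis
      by (intro exI[of _ "S \<times> {..<c}"]) (auto intro: open_Times)
  qed
  then show ?thesis unfolding closed_def by (subst open_subopen) blast
qed

lemma convex_epi:
  assumes "convex_fun f"
  shows "convex (epi f)"
  unfolding convex_alt
proof (intro ballI allI impI, elim conjE)
  fix z w :: "'a \<times> real" and s :: real
  assume zw: "z \<in> epi f" "w \<in> epi f" and s: "0 \<le> s" "s \<le> 1"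
  obtain x a y b where z: "z = (x, a)" and w: "w = (y, b)" by fastforce
  show "(1 - s) *\<^sub>R z + s *\<^sub>R w \<in> epi f"
  proof (cases "s = 0 \<or> s = 1")
    case False
    with s have s01: "0 < s" "s < 1" by auto
    then have "f ((1 - s) *\<^sub>R x + s *\<^sub>R y) \<le> ereal (1 - s) * f x + ereal s * f y"
      using assms by (simp add: convex_fun_def)
    also have "\<dots> \<le> ereal (1 - s) * ereal a + ereal s * ereal b"
      using zw s01 by (intro add_mono ereal_mult_left_mono) (auto simp: z w epi_def)
    finally show ?thesis by (simp add: z w epi_def)
  qed (use zw in auto)
qed

lemma convex_epi_image:
  assumes "convex_fun g" "linear L"
  shows "convex (epi_image L g)"
proof -
  interpret linear L by fact
  have "linear (\<lambda>(u, a :: real). (L u, a))"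
    by (rule linearI) (auto simp: add scale)
  then show ?thesis
    unfolding epi_image_def by (intro convex_linear_image convex_epi assms)
qed

text \<open>A preimage \<open>v\<close> of \<open>L\<^sup>* w\<close> under \<open>L\<^sup>* L\<close> is the weak limit of every sequence \<open>u n\<close> with
  \<open>L (u n) \<longlonglongrightarrow> w\<close>: every test vector has the form \<open>L\<^sup>* (L y)\<close> and \<open>u n \<bullet> L\<^sup>* (L y) = L (u n) \<bullet> L y\<close>.\<close>

lemma weak_lim_of_image:
  fixes L :: "'a::{real_inner, complete_space} \<Rightarrow> 'b::real_inner"
  assumes L: "bounded_linear L" and surj: "surj (adjoint L \<circ> L)" and F: "F \<noteq> bot"
    and lim: "weak_lim (\<lambda>n. L (u n)) w F"
  obtains v where "L v = w" "weak_lim u v F"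
proof -
  note adj = adjoint_inner[OF L]
  obtain v where v: "adjoint L (L v) = adjoint L w"
    using surj by (metis comp_apply surjD)
  have uv: "weak_lim u v F"
    unfolding weak_lim_def
  proof
    fix y
    obtain y' where y': "y = adjoint L (L y')" using surj by (metis comp_apply surjD)
    have "w \<bullet> L y' = L y' \<bullet> w" by (rule inner_commute)
    also have "\<dots> = y' \<bullet> adjoint L (L v)" unfolding v by (rule adj)
    also have "\<dots> = L v \<bullet> L y'" unfolding adj[symmetric] by (rule inner_commute)
    also have "\<dots> = v \<bullet> y" unfolding y' by (rule adj)
    finally show "((\<lambda>n. u n \<bullet> y) \<longlongrightarrow> v \<bullet> y) F"
      using weak_limD[OF lim, of "L y'"] by (simp add: y' adj)
  qed
  have "L v \<bullet> y = w \<bullet> y" for y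
    using tendsto_unique[OF F weak_limD[OF lim, of y]] weak_limD[OF uv, of "adjoint L y"]
    by (simp add: adj)
  then have "(L v - w) \<bullet> (L v - w) = 0" by (simp only: inner_diff_left diff_self)
  then have "L v = w" by simp
  with uv show ?thesis using that by blast
qed

text \<open>A convergent sequence in the image comes from points \<open>(u n, a n)\<close> of the epigraph of \<open>g\<close> for which
  \<open>u n\<close> converges weakly, and a closed convex epigraph is weakly closed.\<close>

lemma closed_epi_image:
  fixes L :: "'a::{real_inner, complete_space} \<Rightarrow> 'b::{real_inner, complete_space}"
  assumes L: "bounded_linear L" and surj: "surj (adjoint L \<circ> L)" and g: "convex_fun g" "lsc_fun g"
  shows "closed (epi_image L g)"
  unfolding closed_sequential_limits
proof (intro allI impI, elim conjE)
  fix Z l assume Z: "\<forall>n. Z n \<in> epi_image L g" and lim: "Z \<longlonglongrightarrow> l"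
  then have "\<forall>n. \<exists>u a. Z n = (L u, a) \<and> (u, a) \<in> epi g"
    by (force simp: epi_image_def)
  then obtain u a where Z_eq: "\<And>n. Z n = (L (u n), a n)" and ua: "\<And>n. (u n, a n) \<in> epi g"
    by metis
  have "(\<lambda>n. L (u n)) \<longlonglongrightarrow> fst l" and a: "a \<longlonglongrightarrow> snd l"
    using tendsto_fst[OF lim] tendsto_snd[OF lim] by (simp_all add: Z_eq)
  then obtain v where v: "L v = fst l" "weak_lim u v sequentially"
    using weak_lim_of_image[OF L surj sequentially_bot tendsto_imp_weak_lim] by blast
  have "(v, snd l) \<in> epi g"
    by (rule convex_closed_weakly_closed[OF closed_epi[OF g(2)] convex_epi[OF g(1)] _
          weak_lim_Pair[OF v(2) tendsto_imp_weak_lim[OF a]] sequentially_bot]) (simp add: ua)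
  then show "l \<in> epi_image L g"
    using v(1) by (cases l) (auto simp: epi_image_def image_iff intro!: bexI[of _ "(v, snd l)"])
qed

section \<open>The optimization steps\<close>

lemma minimizer_imp_subgrad:
  assumes g: "proper_fun g" "convex_fun g" and L: "linear L"
    and min: "is_minimizer (\<lambda>u. g u + ereal (l / 2 * (norm (L u - c))\<^sup>2)) u"
  shows "\<exists>a. subgrad (epi_image L g) (l *\<^sub>R (c - L u)) (L u) a"
proof -
  have min: "g u + ereal (l / 2 * (norm (L u - c))\<^sup>2) \<le> g v + ereal (l / 2 * (norm (L v - c))\<^sup>2)" for v
    using min by (simp add: is_minimizer_iff)
  obtain v where "g v \<noteq> \<infinity>" using g(1) by (auto simp: proper_fun_def)
  moreover have "g u \<noteq> -\<infinity>" using g(1) by (auto simp: proper_fun_def)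
  ultimately obtain a where a: "g u = ereal a"
    using min[of v] by (cases "g u"; cases "g v") auto
  have "subgrad (epi_image L g) (l *\<^sub>R (c - L u)) (L u) a"
  proof (rule minimal_imp_subgrad)
    show "convex (epi_image L g)" by (rule convex_epi_image[OF g(2) L])
    show "(L u, a) \<in> epi_image L g" by (rule epi_imageI) (simp add: a)
    show "a + l / 2 * (norm (L u - c))\<^sup>2 \<le> t + l / 2 * (norm (y - c))\<^sup>2"
      if yt: "(y, t) \<in> epi_image L g" for y t
    proof -
      obtain v where v: "y = L v" "g v \<le> ereal t" using yt by (rule epi_imageE)
      have "ereal (a + l / 2 * (norm (L u - c))\<^sup>2) \<le> g v + ereal (l / 2 * (norm (L v - c))\<^sup>2)"
        using min[of v] by (simp add: a)
      also have "\<dots> \<le> ereal t + ereal (l / 2 * (norm (L v - c))\<^sup>2)"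
        using v(2) by (intro add_mono) auto
      finally show ?thesis by (simp add: v(1))
    qed
  qed
  then show ?thesis by blast
qed

lemma subgrad_imp_minimizer:
  assumes "subgrad (epi_image L g) (l *\<^sub>R (c - x)) x a" "0 \<le> l"
  shows "\<exists>u. is_minimizer (\<lambda>u. g u + ereal (l / 2 * (norm (L u - c))\<^sup>2)) u"
proof -
  obtain u where u: "x = L u" "g u \<le> ereal a"
    using subgrad_in[OF assms(1)] by (rule epi_imageE)
  have "g u + ereal (l / 2 * (norm (L u - c))\<^sup>2) \<le> g v + ereal (l / 2 * (norm (L v - c))\<^sup>2)" for v
  proof (rule ereal_le_real)
    fix s assume s: "g v + ereal (l / 2 * (norm (L v - c))\<^sup>2) \<le> ereal s"
    then have "g v \<le> ereal (s - l / 2 * (norm (L v - c))\<^sup>2)"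
      by (cases "g v") auto
    then have "(L v, s - l / 2 * (norm (L v - c))\<^sup>2) \<in> epi_image L g" by (rule epi_imageI)
    from subgrad_imp_minimal[OF assms(1) this assms(2)]
    have "a + l / 2 * (norm (L u - c))\<^sup>2 \<le> s" by (simp add: u(1))
    moreover have "g u + ereal (l / 2 * (norm (L u - c))\<^sup>2) \<le> ereal a + ereal (l / 2 * (norm (L u - c))\<^sup>2)"
      using u(2) by (intro add_mono) auto
    ultimately show "g u + ereal (l / 2 * (norm (L u - c))\<^sup>2) \<le> ereal s"
      by (metis ereal_less_eq(3) order_trans plus_ereal.simps(1))
  qed
  then show ?thesis unfolding is_minimizer_iff by blast
qed

text \<open>An affine minorant bounds the proximal objective from below, by completing the square.\<close>

lemma proximal_point_exists_if_subgrad: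
  fixes E :: "('a::{real_inner, complete_space} \<times> real) set"
  assumes E: "closed E" "convex E" and l: "0 < l" and sg: "subgrad E q y b"
  shows "\<exists>x a. subgrad E (l *\<^sub>R (c - x)) x a"
proof (rule proximal_point_exists[OF E _ l])
  show "E \<noteq> {}" using subgrad_in[OF sg] by auto
  show "b + q \<bullet> (c - y) - (q \<bullet> q) / (2 * l) \<le> a + l / 2 * (norm (x - c))\<^sup>2" if "(x, a) \<in> E" for x a
  proof -
    define P where "P = q \<bullet> (x - c)"
    have expand: "(norm (v + s *\<^sub>R q))\<^sup>2 = (norm v)\<^sup>2 + 2 * s * (q \<bullet> v) + s\<^sup>2 * (q \<bullet> q)" for v s
      unfolding power2_norm_eq_inner
      by (simp add: power2_eq_square inner_add_left inner_add_right inner_commute[of v q] algebra_simps)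
    have "0 \<le> l / 2 * (norm ((x - c) + inverse l *\<^sub>R q))\<^sup>2" using l by simp
    also have "(norm ((x - c) + inverse l *\<^sub>R q))\<^sup>2
        = (norm (x - c))\<^sup>2 + 2 * inverse l * P + (inverse l)\<^sup>2 * (q \<bullet> q)"
      unfolding P_def by (rule expand)
    also have "l / 2 * \<dots> = l / 2 * (norm (x - c))\<^sup>2 + P + (q \<bullet> q) / (2 * l)"
      using l by (simp add: field_simps power2_eq_square)
    finally show ?thesis
      using subgrad_le[OF sg that] by (simp add: P_def inner_diff_right)
  qed
qed

section \<open>Duality in terms of epigraphs\<close>

lemma fenchel_conj_le_iff:
  assumes "proper_fun f"
  shows "fenchel_conj f y \<le> ereal s \<longleftrightarrow> (\<forall>x a. f x \<le> ereal a \<longrightarrow> x \<bullet> y - a \<le> s)"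
proof -
  have "ereal (x \<bullet> y) - f x \<le> ereal s \<longleftrightarrow> (\<forall>a. f x \<le> ereal a \<longrightarrow> x \<bullet> y - a \<le> s)" for x
    using assms by (cases "f x") (auto simp: proper_fun_def)
  then show ?thesis by (simp add: fenchel_conj_def SUP_le_iff)
qed

lemma fenchel_conj_not_MInf:
  assumes "proper_fun f"
  shows "fenchel_conj f y \<noteq> -\<infinity>"
proof -
  obtain x a where "f x = ereal a"
    using assms unfolding proper_fun_def by (metis ereal_cases)
  then have "ereal (x \<bullet> y - a) \<le> fenchel_conj f y"
    unfolding fenchel_conj_def by (intro SUP_upper2[of x]) auto
  then show ?thesis by auto
qed

text \<open>The two conjugates are bounded separately.  This is possible since neither takes the value
  \<open>-\<infinity>\<close>, and it removes extended reals from all duality arguments.\<close>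

lemma dual_obj_le_iff:
  fixes L :: "'a::{real_inner, complete_space} \<Rightarrow> 'b::real_inner"
  assumes g: "proper_fun g" and f: "proper_fun f" and L: "bounded_linear L"
  shows "dual_obj g f L p \<le> ereal s \<longleftrightarrow>
    (\<exists>A B. A + B \<le> s \<and> (\<forall>x a. (x, a) \<in> epi_image L g \<longrightarrow> - (p \<bullet> x) - a \<le> A) \<and>
       (\<forall>x b. (x, b) \<in> epi f \<longrightarrow> p \<bullet> x - b \<le> B))"
proof -
  have eq: "x \<bullet> (- adjoint L p) = - (p \<bullet> L x)" for x
    by (simp add: inner_commute[of p] adjoint_inner[OF L])
  have G: "fenchel_conj g (- adjoint L p) \<le> ereal A \<longleftrightarrow>
      (\<forall>x a. (x, a) \<in> epi_image L g \<longrightarrow> - (p \<bullet> x) - a \<le> A)" for A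
    unfolding fenchel_conj_le_iff[OF g] eq by (blast elim: epi_imageE intro: epi_imageI)
  have F: "fenchel_conj f p \<le> ereal B \<longleftrightarrow> (\<forall>x b. (x, b) \<in> epi f \<longrightarrow> p \<bullet> x - b \<le> B)" for B
    unfolding fenchel_conj_le_iff[OF f] by (simp add: epi_def inner_commute)
  have "G' + F' \<le> ereal s \<longleftrightarrow> (\<exists>A B. A + B \<le> s \<and> G' \<le> ereal A \<and> F' \<le> ereal B)"
    if "G' \<noteq> -\<infinity>" "F' \<noteq> -\<infinity>" for G' F' :: ereal
    using that by (cases G'; cases F') (auto intro: exI[of _ "real_of_ereal G'"])
  from this[OF fenchel_conj_not_MInf[OF g, of "- adjoint L p"] fenchel_conj_not_MInf[OF f, of p]]
  show ?thesis unfolding dual_obj_def by (simp only: G F)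
qed

text \<open>Keeping \<open>u\<close> fixed and perturbing only the argument of \<open>f\<close> suffices here.\<close>

lemma continuous_imp_perturbation_bounded:
  assumes R1: "regularity_R1 g f L"
  shows "perturbation_bounded (epi_image L g) (epi f)"
proof -
  obtain u where u: "g u < \<infinity>" "f (L u) < \<infinity>" "isCont f (L u)"
    using R1 by (auto simp: regularity_R1_def eff_dom_def)
  obtain a where a: "g u \<le> ereal a" using u(1) by (cases "g u") auto
  obtain b where b: "f (L u) < ereal b" using u(2) ereal_dense2 by blast
  have "eventually (\<lambda>y. f y < ereal b) (at (L u))"
    using u(3) b unfolding isCont_def by (rule order_tendstoD(2))
  then obtain r where r: "0 < r" "\<And>y. y \<noteq> L u \<Longrightarrow> dist y (L u) < r \<Longrightarrow> f y < ereal b"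
    by (auto simp: eventually_at)
  have La: "(L u, a) \<in> epi_image L g" using a by (rule epi_imageI)
  have "\<exists>x a' b'. (x, a') \<in> epi_image L g \<and> (x + y, b') \<in> epi f \<and> a' + b' \<le> a + b" if "norm y < r" for y
  proof -
    have "(L u + y, b) \<in> epi f"
      using r(2)[of "L u + y"] b that by (cases "y = 0") (auto simp: epi_def dist_norm less_imp_le)
    with La show ?thesis by blast
  qed
  with r(1) show ?thesis unfolding perturbation_bounded_def by blast
qed

lemma regularity_imp_perturbation_bounded:
  fixes L :: "'a::{real_inner, complete_space} \<Rightarrow> 'b::{real_inner, complete_space}"
  assumes "closed (epi_image L g)" "convex (epi_image L g)" "closed (epi f)" "convex (epi f)"
    and "regularity_R1 g f L \<or> regularity_R2 g f L"
  shows "perturbation_bounded (epi_image L g) (epi f)"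
  using assms(5)
proof
  assume "regularity_R2 g f L"
  moreover have "{L x - y | x y. x \<in> eff_dom g \<and> y \<in> eff_dom f}
      = {x - y | x y. x \<in> fst ` epi_image L g \<and> y \<in> fst ` epi f}"
    using fst_epi_image[of "\<lambda>x. x" f] by (auto simp: fst_epi_image epi_image_id)
  ultimately have "0 \<in> interior {x - y | x y. x \<in> fst ` epi_image L g \<and> y \<in> fst ` epi f}"
    by (simp add: regularity_R2_def)
  then show ?thesis
    using assms(1-4) epi_image_upward[of _ _ "\<lambda>x. x" f]
    by (intro interior_imp_perturbation_bounded) (auto simp: epi_image_id intro: epi_image_upward)
qed (rule continuous_imp_perturbation_bounded)

text \<open>The primal value is finite because the perturbation function is bounded above at the origin.  By
  approximate duality the dual optimal value exceeds the negative of the primal one by at most \<open>e\<close>, for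
  each \<open>e > 0\<close>; hence there is no gap and the Fenchel--Young inequalities at the two solutions are equations.\<close>

lemma solutions_imp_saddle_point:
  fixes L :: "'a::{real_inner, complete_space} \<Rightarrow> 'b::{real_inner, complete_space}"
  assumes g: "proper_fun g" and f: "proper_fun f" and L: "bounded_linear L"
    and cvx: "convex (epi_image L g)" "convex (epi f)"
    and pb: "perturbation_bounded (epi_image L g) (epi f)"
    and primal: "primal_solution g f L u" and dual: "dual_solution g f L p"
  shows "saddle_point (epi_image L g) (epi f) p (L u)"
proof -
  obtain x a b where "(x, a) \<in> epi_image L g" "(x, b) \<in> epi f"
    using pb unfolding perturbation_bounded_def by (metis add.right_neutral norm_zero)
  then obtain v where v: "g v \<le> ereal a" "f (L v) \<le> ereal b"
    by (auto elim!: epi_imageE simp: epi_def)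
  have min: "g u + f (L u) \<le> g v + f (L v)" for v
    using primal by (simp add: primal_solution_def is_minimizer_iff primal_obj_def)
  have "g u \<noteq> -\<infinity>" "f (L u) \<noteq> -\<infinity>" using g f by (auto simp: proper_fun_def)
  moreover have "g u + f (L u) \<le> ereal a + ereal b"
    using min[of v] add_mono[OF v] by (rule order_trans)
  ultimately obtain s t where st: "g u = ereal s" "f (L u) = ereal t"
    by (cases "g u"; cases "f (L u)") auto
  have v: "s + t \<le> a + b" if xab: "(x, a) \<in> epi_image L g" "(x, b) \<in> epi f" for x a b
  proof -
    obtain v where v: "x = L v" "g v \<le> ereal a" using xab(1) by (rule epi_imageE)
    have "ereal (s + t) \<le> g v + f (L v)" using min[of v] by (simp add: st)
    also have "\<dots> \<le> ereal a + ereal b" using v xab(2) by (intro add_mono) (auto simp: epi_def)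
    finally show ?thesis by simp
  qed
  have in_epi: "(L u, s) \<in> epi_image L g" "(L u, t) \<in> epi f"
    by (auto intro!: epi_imageI simp: st epi_def)
  have approx: "dual_obj g f L p \<le> ereal (- (s + t)) + ereal e" if "0 < e" for e
  proof -
    have "\<exists>q. \<forall>x a y b. (x, a) \<in> epi_image L g \<longrightarrow> (y, b) \<in> epi f \<longrightarrow>
        (s + t) - e \<le> a + b + q \<bullet> (x - y)"
      by (rule approximate_dual_exists[OF cvx pb v \<open>0 < e\<close>])
    then obtain q where q: "\<And>x a y b. (x, a) \<in> epi_image L g \<Longrightarrow> (y, b) \<in> epi f \<Longrightarrow> s + t - e \<le> a + b + q \<bullet> (x - y)"
      by blast
    \<comment> \<open>the conjugate of \<open>g\<close> at \<open>- L\<^sup>* q\<close>; it splits the joint bound into one for each conjugate\<close>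
    define A where "A = Sup {- (q \<bullet> x) - a | x a. (x, a) \<in> epi_image L g}"
    have le: "- (q \<bullet> x) - a \<le> e - (s + t) - (q \<bullet> y - b)" if "(x, a) \<in> epi_image L g" "(y, b) \<in> epi f" for x a y b
      using q[OF that] by (simp add: inner_diff_right)
    have "- (q \<bullet> x) - a \<le> A" if "(x, a) \<in> epi_image L g" for x a
      unfolding A_def using that le[OF _ in_epi(2)]
      by (intro cSup_upper) (auto intro!: bdd_aboveI)
    moreover have "A \<le> e - (s + t) - (q \<bullet> y - b)" if "(y, b) \<in> epi f" for y b
      unfolding A_def using in_epi(1) le[OF _ that] by (intro cSup_least) auto
    then have "q \<bullet> y - b \<le> e - (s + t) - A" if "(y, b) \<in> epi f" for y b
      using that by fastforce
    ultimately have "dual_obj g f L q \<le> ereal (e - (s + t))"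
      unfolding dual_obj_le_iff[OF g f L] by (intro exI[of _ A] exI[of _ "e - (s + t) - A"]) auto
    moreover have "dual_obj g f L p \<le> dual_obj g f L q"
      using dual by (simp add: dual_solution_def is_minimizer_iff)
    ultimately show ?thesis by (simp add: algebra_simps)
  qed
  have "dual_obj g f L p \<le> ereal (- (s + t))"
    by (rule ereal_le_epsilon2) (rule approx)
  then obtain A B where "A + B \<le> - (s + t)"
    "\<And>x a. (x, a) \<in> epi_image L g \<Longrightarrow> - (p \<bullet> x) - a \<le> A"
    "\<And>x b. (x, b) \<in> epi f \<Longrightarrow> p \<bullet> x - b \<le> B"
    unfolding dual_obj_le_iff[OF g f L] by blast
  from zero_gap_imp_subgrad[OF this(2,3,1) in_epi] show ?thesis
    unfolding saddle_point_def by blast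
qed

lemma saddle_point_imp_dual_solution:
  fixes L :: "'a::{real_inner, complete_space} \<Rightarrow> 'b::real_inner"
  assumes g: "proper_fun g" and f: "proper_fun f" and L: "bounded_linear L"
    and saddle: "saddle_point (epi_image L g) (epi f) p x"
  shows "dual_solution g f L p"
proof -
  obtain a b where ab: "subgrad (epi_image L g) (- p) x a" "subgrad (epi f) p x b"
    using saddle by (auto simp: saddle_point_def)
  have "dual_obj g f L p \<le> ereal (- a - b)"
    unfolding dual_obj_le_iff[OF g f L]
    using subgrad_le[OF ab(1)] subgrad_le[OF ab(2)]
    by (intro exI[of _ "- (p \<bullet> x) - a"] exI[of _ "p \<bullet> x - b"]) (fastforce simp: inner_diff_right)
  moreover have "ereal (- a - b) \<le> dual_obj g f L q" for q
  proof (rule ereal_le_real)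
    fix s assume "dual_obj g f L q \<le> ereal s"
    then show "ereal (- a - b) \<le> ereal s"
      unfolding dual_obj_le_iff[OF g f L]
      using subgrad_in[OF ab(1)] subgrad_in[OF ab(2)] by fastforce
  qed
  ultimately show ?thesis
    unfolding dual_solution_def is_minimizer_iff by (blast intro: order_trans)
qed

lemma saddle_point_imp_primal_solution:
  assumes saddle: "saddle_point (epi_image L g) (epi f) p x"
  shows "\<exists>u. L u = x"
    and "inj L \<Longrightarrow> L u = x \<Longrightarrow> proper_fun g \<Longrightarrow> proper_fun f \<Longrightarrow> primal_solution g f L u"
proof -
  obtain a b where ab: "subgrad (epi_image L g) (- p) x a" "subgrad (epi f) p x b"
    using saddle by (auto simp: saddle_point_def)
  obtain v where v: "x = L v" "g v \<le> ereal a" using subgrad_in[OF ab(1)] by (rule epi_imageE)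
  then show "\<exists>u. L u = x" by blast
  assume inj: "inj L" and u: "L u = x" and g: "proper_fun g" and f: "proper_fun f"
  have "u = v" using inj u v(1) by (simp add: inj_eq)
  then have up: "g u + f (L u) \<le> ereal a + ereal b"
    using v(2) subgrad_in[OF ab(2)] u by (intro add_mono) (auto simp: epi_def)
  have low: "ereal a + ereal b \<le> g w + f (L w)" for w
  proof -
    have "a + b \<le> s + t" if "g w = ereal s" "f (L w) = ereal t" for s t
      using subgrad_le[OF ab(1) epi_imageI, of w s] subgrad_le[OF ab(2), of "L w" t] that
      by (simp add: epi_def)
    moreover have "g w \<noteq> -\<infinity>" "f (L w) \<noteq> -\<infinity>" using g f by (auto simp: proper_fun_def)
    ultimately show ?thesis by (cases "g w"; cases "f (L w)") auto
  qed
  show "primal_solution g f L u"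
    using order_trans[OF up low] by (simp add: primal_solution_def is_minimizer_iff primal_obj_def)
qed

section \<open>The alternating split Bregman algorithm\<close>

lemma asb_I1_eq:
  "asb_I1 g L lam b d = (\<lambda>u. g u + ereal (lam / 2 * (norm (L u - (d - b)))\<^sup>2))"
  by (simp add: asb_I1_def fun_eq_iff algebra_simps)

lemma asb_I2_eq:
  "asb_I2 f L lam b u = (\<lambda>d. f d + ereal (lam / 2 * (norm (d - (b + L u)))\<^sup>2))"
  by (simp add: asb_I2_def fun_eq_iff norm_minus_commute)

text \<open>A kernel element \<open>x - y\<close> has the form \<open>L\<^sup>* (L v)\<close>, so \<open>\<parallel>x - y\<parallel>\<^sup>2 = L (x - y) \<bullet> L v = 0\<close>.\<close>

lemma surj_adjoint_comp_imp_inj: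
  fixes L :: "'a::{real_inner, complete_space} \<Rightarrow> 'b::real_inner"
  assumes L: "bounded_linear L" and surj: "surj (adjoint L \<circ> L)"
  shows "inj L"
proof (rule injI)
  fix x y assume "L x = L y"
  then have 0: "L (x - y) = 0"
    by (simp add: linear_diff[OF bounded_linear.linear[OF L]])
  obtain v where v: "x - y = adjoint L (L v)" using surj by (metis comp_apply surjD)
  have "(x - y) \<bullet> (x - y) = L (x - y) \<bullet> L v"
    by (subst (2) v) (rule adjoint_inner[OF L, symmetric])
  then have "(x - y) \<bullet> (x - y) = 0" by (simp only: 0 inner_zero_left)
  then have "x - y = 0" by (simp only: inner_eq_zero_iff)
  then show "x = y" by simp
qed

text \<open>If \<open>L v\<close> and \<open>x\<close> were different, an open half space between them, pulled back by \<open>L\<close>, would be a weak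
  neighbourhood of \<open>v\<close> that \<open>u\<close> leaves eventually.\<close>

lemma weak_cluster_point_image:
  fixes L :: "'a::{real_inner, complete_space} \<Rightarrow> 'b::real_inner"
  assumes L: "bounded_linear L" and cluster: "weak_cluster_point u v"
    and lim: "\<And>y. (\<lambda>k. L (u k) \<bullet> y) \<longlonglongrightarrow> x \<bullet> y"
  shows "L v = x"
proof (rule ccontr)
  assume "L v \<noteq> x"
  define y where "y = L v - x"
  have y: "0 < y \<bullet> y" using \<open>L v \<noteq> x\<close> by (simp add: y_def)
  define U where "U = {w. w \<bullet> adjoint L y \<in> {x \<bullet> y + y \<bullet> y / 2 <..}}"
  have "openin weak_topology U"
    unfolding U_def by (rule openin_weak_topology_subbasis) simp
  moreover have "L v \<bullet> y = x \<bullet> y + y \<bullet> y"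
    by (simp add: y_def inner_diff_left)
  then have "v \<in> U" using y by (simp add: U_def adjoint_inner[OF L, symmetric])
  ultimately have "\<exists>\<^sub>F n in sequentially. u n \<in> U"
    using cluster by (simp add: weak_cluster_point_def)
  moreover have "\<forall>\<^sub>F n in sequentially. L (u n) \<bullet> y < x \<bullet> y + y \<bullet> y / 2"
    using order_tendstoD(2)[OF lim, of y "x \<bullet> y + y \<bullet> y / 2"] y by simp
  then have "\<forall>\<^sub>F n in sequentially. u n \<notin> U"
    by eventually_elim (simp add: U_def adjoint_inner[OF L, symmetric])
  ultimately show False by (simp add: frequently_def)
qed

theorem theorem1p1:
  fixes g :: "'a::{real_inner, complete_space} \<Rightarrow> ereal"
    and f :: "'b::{real_inner, complete_space} \<Rightarrow> ereal"
    and L :: "'a \<Rightarrow> 'b"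
    and lam :: real
    and b0 d0 :: 'b
  assumes "proper_fun g" "convex_fun g" "lsc_fun g"
    and "proper_fun f" "convex_fun f" "lsc_fun f"
    and "bounded_linear L"
    and "lam > 0"
    and "\<exists>u. primal_solution g f L u"
    and "\<exists>p. dual_solution g f L p"
    and "regularity_R1 g f L \<or> regularity_R2 g f L"
    and "surj (adjoint L \<circ> L)"
  shows "asb_well_defined g f L lam b0 d0 \<and>
    (\<forall>u d b. asb_sequence g f L lam b0 d0 u d b \<longrightarrow>
      (\<exists>bhat dhat.
         weakly_converges b bhat \<and>
         weakly_converges d dhat \<and>
         dual_solution g f L (lam *\<^sub>R bhat) \<and>
         (\<lambda>k. d k - L (u (Suc k))) \<longlonglongrightarrow> 0 \<and>
         summable (\<lambda>k. (norm (d k - L (u (Suc k))))\<^sup>2) \<and>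
         (\<exists>uhat.
            L uhat = dhat \<and>
            (\<forall>v. L v = dhat \<longrightarrow> v = uhat) \<and>
            primal_solution g f L uhat \<and>
            (\<exists>\<^sub>\<le>\<^sub>1 ubar. weak_cluster_point u ubar) \<and>
            (\<forall>ubar. weak_cluster_point u ubar \<longrightarrow> ubar = uhat))))"
proof -
  note g = assms(1-3) and f = assms(4-6) and L = assms(7) and lam = assms(8) and surj = assms(12)
  have lin: "linear L" using L by (rule bounded_linear.linear)
  have inj: "inj L" using L surj by (rule surj_adjoint_comp_imp_inj)
  let ?E = "epi_image L g" and ?F = "epi f"
  have E: "closed ?E" "convex ?E"
    using closed_epi_image[OF L surj g(2,3)] convex_epi_image[OF g(2) lin] .
  have F: "closed ?F" "convex ?F"
    using closed_epi[OF f(3)] convex_epi[OF f(2)] .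
  obtain u0 p0 where "primal_solution g f L u0" "dual_solution g f L p0"
    using assms(9,10) by blast
  then have saddle: "saddle_point ?E ?F p0 (L u0)"
    using solutions_imp_saddle_point[OF g(1) f(1) L E(2) F(2)]
      regularity_imp_perturbation_bounded[OF E F assms(11)] by blast
  have min1: "\<exists>u. is_minimizer (asb_I1 g L lam b d) u" for b d
  proof -
    obtain x a where "subgrad ?E (lam *\<^sub>R ((d - b) - x)) x a"
      using proximal_point_exists_if_subgrad[OF E lam] saddle unfolding saddle_point_def by meson
    then show ?thesis
      unfolding asb_I1_eq using lam by (intro subgrad_imp_minimizer) auto
  qed
  have min2: "\<exists>d. is_minimizer (asb_I2 f L lam b u) d" for b u
  proof -
    obtain x a where "subgrad ?F (lam *\<^sub>R ((b + L u) - x)) x a"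
      using proximal_point_exists_if_subgrad[OF F lam] saddle unfolding saddle_point_def by meson
    then show ?thesis
      unfolding asb_I2_eq using lam subgrad_imp_minimizer[of "\<lambda>x. x" f lam "b + L u" x a]
      by (simp add: epi_image_id)
  qed
  have "asb_well_defined g f L lam b0 d0"
    unfolding asb_well_defined_def using min1 min2 by blast
  moreover have "\<exists>bhat dhat.
         weakly_converges b bhat \<and>
         weakly_converges d dhat \<and>
         dual_solution g f L (lam *\<^sub>R bhat) \<and>
         (\<lambda>k. d k - L (u (Suc k))) \<longlonglongrightarrow> 0 \<and>
         summable (\<lambda>k. (norm (d k - L (u (Suc k))))\<^sup>2) \<and>
         (\<exists>uhat.
            L uhat = dhat \<and>
            (\<forall>v. L v = dhat \<longrightarrow> v = uhat) \<and>
            primal_solution g f L uhat \<and>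
            (\<exists>\<^sub>\<le>\<^sub>1 ubar. weak_cluster_point u ubar) \<and>
            (\<forall>ubar. weak_cluster_point u ubar \<longrightarrow> ubar = uhat))"
    if seq: "asb_sequence g f L lam b0 d0 u d b" for u d b
  proof -
    have step: "asb_step g f L lam (b k) (d k) (u (Suc k)) (d (Suc k)) (b (Suc k))" for k
      using seq by (simp add: asb_sequence_def)
    have b_Suc: "b (Suc k) + d (Suc k) = b k + L (u (Suc k))" for k
      using step[of k] by (simp add: asb_step_def)
    have "\<exists>a. subgrad ?E (lam *\<^sub>R (- (b k + L (u (Suc k)) - d k))) (L (u (Suc k))) a" for k
    proof -
      have "is_minimizer (\<lambda>v. g v + ereal (lam / 2 * (norm (L v - (d k - b k)))\<^sup>2)) (u (Suc k))"
        using step[of k] by (simp add: asb_step_def asb_I1_eq)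
      from minimizer_imp_subgrad[OF g(1,2) lin this] show ?thesis
        by (simp add: algebra_simps)
    qed
    then obtain \<alpha> where \<alpha>: "\<And>k. subgrad ?E (lam *\<^sub>R (- (b k + L (u (Suc k)) - d k))) (L (u (Suc k))) (\<alpha> k)"
      by metis
    have "\<exists>a. subgrad ?F (lam *\<^sub>R b (Suc k)) (d (Suc k)) a" for k
    proof -
      have "is_minimizer (\<lambda>v. f v + ereal (lam / 2 * (norm (v - (b k + L (u (Suc k)))))\<^sup>2)) (d (Suc k))"
        using step[of k] by (simp add: asb_step_def asb_I2_eq)
      from minimizer_imp_subgrad[OF f(1,2) linear_id[unfolded id_def] this]
      have "\<exists>a. subgrad ?F (lam *\<^sub>R (b k + L (u (Suc k)) - d (Suc k))) (d (Suc k)) a"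
        unfolding epi_image_id .
      then show ?thesis by (simp only: b_Suc[symmetric] add_diff_cancel_right')
    qed
    then obtain \<beta> where \<beta>: "\<And>k. subgrad ?F (lam *\<^sub>R b (Suc k)) (d (Suc k)) (\<beta> k)"
      by metis
    \<comment> \<open>The initial \<open>d0\<close> and \<open>b0\<close> satisfy no optimality condition, hence the shift of all sequences by one.\<close>
    interpret dr: douglas_rachford ?E ?F lam "\<lambda>k. b (Suc k)" "\<lambda>k. d (Suc k)"
      "\<lambda>k. L (u (Suc (Suc k)))" "\<lambda>k. \<alpha> (Suc k)" \<beta>
    proof
      have "lam *\<^sub>R (inverse lam *\<^sub>R p0) = p0" using lam by simp
      with saddle have "saddle_point ?E ?F (lam *\<^sub>R (inverse lam *\<^sub>R p0)) (L u0)" by (simp only:)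
      then show "\<exists>p x. saddle_point ?E ?F (lam *\<^sub>R p) x" by (intro exI)
    qed (fact E F lam \<alpha> \<beta> b_Suc)+
    obtain bhat dhat where lim: "weak_lim (\<lambda>k. b (Suc k)) bhat sequentially"
        "weak_lim (\<lambda>k. d (Suc k)) dhat sequentially"
      and hat: "saddle_point ?E ?F (lam *\<^sub>R bhat) dhat"
      using dr.weak_convergence by blast
    have "weakly_converges b bhat" "weakly_converges d dhat"
      unfolding weakly_converges_iff
      by (rule allI, rule LIMSEQ_imp_Suc, rule lim[THEN weak_limD])+
    moreover have "dual_solution g f L (lam *\<^sub>R bhat)"
      by (rule saddle_point_imp_dual_solution[OF g(1) f(1) L hat])
    moreover have residual: "(\<lambda>k. d k - L (u (Suc k))) \<longlonglongrightarrow> 0"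
      by (rule LIMSEQ_imp_Suc) (use tendsto_minus[OF dr.residuals_tendsto_0] in simp)
    moreover have "summable (\<lambda>k. (norm (d k - L (u (Suc k))))\<^sup>2)"
      using dr.summable_residuals by (subst (asm) summable_Suc_iff)
    moreover obtain uhat where uhat: "L uhat = dhat"
      using saddle_point_imp_primal_solution(1)[OF hat] by blast
    moreover have "\<forall>v. L v = dhat \<longrightarrow> v = uhat"
      using inj uhat by (auto dest: injD)
    moreover have "primal_solution g f L uhat"
      by (rule saddle_point_imp_primal_solution(2)[OF hat inj uhat g(1) f(1)])
    moreover have "ubar = uhat" if cluster: "weak_cluster_point u ubar" for ubar
    proof -
      have "(\<lambda>k. L (u k) \<bullet> y) \<longlonglongrightarrow> dhat \<bullet> y" for y
      proof (rule LIMSEQ_imp_Suc)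
        have "(\<lambda>k. d k \<bullet> y) \<longlonglongrightarrow> dhat \<bullet> y"
          using weak_limD[OF lim(2)] by (rule LIMSEQ_imp_Suc)
        from tendsto_diff[OF this tendsto_inner[OF residual tendsto_const, of y]]
        show "(\<lambda>k. L (u (Suc k)) \<bullet> y) \<longlonglongrightarrow> dhat \<bullet> y"
          by (simp add: inner_diff_left)
      qed
      then have "L ubar = L uhat"
        unfolding uhat by (rule weak_cluster_point_image[OF L cluster])
      then show ?thesis using inj by (rule injD[rotated])
    qed
    ultimately show ?thesis unfolding Uniq_def by blast
  qed
  ultimately show ?thesis by blast
qed

end
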